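(* For any $n\ge 1$, let $SO(n)$ act on $\mathbb{R}P^n$ by $g\cdot[v]=[gv]$ for $g\in SO(n)$ and $v\in\mathbb{R}^{n+1}\setminus\{\vec 0\}$, where $SO(n)$ acts on $\mathbb{R}^{n+1}$ via the embedding $SO(n)\hookrightarrow SO(n+1)$, $A\mapsto\begin{bmatrix}A&0\\0&1\end{bmatrix}$. Then $$\mathrm{dTC}_{SO(n)}(\mathbb{R}P^n)=1.$$
   Context: $I=[0,1]$; path spaces carry the compact-open topology. For a metric space $X$ and $k\ge 1$, $\mathcal{B}_k(X)$ is the set of probability measures on $X$ supported on at most $k$ points, with the Lévy–Prokhorov metric topology. For a topological group $G$ and a $G$-fibration $p\colon E\to B$ (a $G$-map with the homotopy lifting property for $G$-equivariant homotopies) with $E$ metric, let $E_k(p)=\{\mu\in\mathcal{B}_k(E)\mid \mathrm{supp}(\mu)\subset p^{-1}(x)\text{ for some }x\in B\}$, with $G$-action $g\cdot\sum\lambda_e e=\sum\lambda_e\, (g e)$, and let $\mathcal{B}_k(p)\colon E_k(p)\to B$ be the $G$-fibration sending $\mu$ to $x$ if $\mathrm{supp}(\mu)\subset p^{-1}(x)$. The equivariant distributional sectional category $\mathrm{dsecat}_G(p)$ is the smallest integer $n\ge0$ such that $\mathcal{B}_{n+1}(p)$ admits a $G$-equivariant (continuous) section. For a $G$-space $X$, $X^I$ has the $G$-action $(g\phi)(t)=g\cdot\phi(t)$ and $X\times X$ the diagonal action. The equivariant distributional complexity is $\mathrm{dTC}_G(X):=\mathrm{dsecat}_G(\pi_2^X)$,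 where $\pi_2^X\colon X^I\to X\times X$, $\phi\mapsto(\phi(0),\phi(1))$. *)

theory Defs
  imports "HOL-Probability.Probability" "HOL-Library.Extended_Nat"
begin

section \<open>Finitely supported probability measures and the Levy-Prokhorov metric\<close>

text \<open>
  A probability measure supported on finitely many points is the same thing as a \<^typ>\<open>'e pmf\<close>
  with finite \<^const>\<open>set_pmf\<close>, which is its support.  A metric space is given as in the library
  by a carrier \<open>M\<close> and a distance function \<open>d\<close>.
\<close>

definition finsupp_measures :: "'e set \<Rightarrow> nat \<Rightarrow> 'e pmf set" where
  "finsupp_measures M k = {\<mu>. set_pmf \<mu> \<subseteq> M \<and> finite (set_pmf \<mu>) \<and> card (set_pmf \<mu>) \<le> k}"

definition borel_subsets :: "'e set \<Rightarrow> ('e \<Rightarrow> 'e \<Rightarrow> real) \<Rightarrow> 'e set set" where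
  "borel_subsets M d = sigma_sets M {U. openin (Metric_space.mtopology M d) U}"

definition thickening :: "'e set \<Rightarrow> ('e \<Rightarrow> 'e \<Rightarrow> real) \<Rightarrow> real \<Rightarrow> 'e set \<Rightarrow> 'e set" where
  "thickening M d \<epsilon> A = {x \<in> M. \<exists>a\<in>A. d a x < \<epsilon>}"

definition levy_prokhorov :: "'e set \<Rightarrow> ('e \<Rightarrow> 'e \<Rightarrow> real) \<Rightarrow> 'e pmf \<Rightarrow> 'e pmf \<Rightarrow> real" where
  "levy_prokhorov M d \<mu> \<nu> =
     Inf {\<epsilon>. \<epsilon> > 0 \<and> (\<forall>A \<in> borel_subsets M d.
            measure_pmf.prob \<mu> A \<le> measure_pmf.prob \<nu> (thickening M d \<epsilon> A) + \<epsilon> \<and>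
            measure_pmf.prob \<nu> A \<le> measure_pmf.prob \<mu> (thickening M d \<epsilon> A) + \<epsilon>)}"

definition finsupp_topology :: "'e set \<Rightarrow> ('e \<Rightarrow> 'e \<Rightarrow> real) \<Rightarrow> nat \<Rightarrow> 'e pmf topology" where
  "finsupp_topology M d k =
     Metric_space.mtopology (finsupp_measures M k) (levy_prokhorov M d)"

section \<open>Equivariant distributional sectional category\<close>

text \<open>
  In the following, \<open>p\<close> maps the metric space \<open>(E, d)\<close> to the topological space \<open>B\<close>, and
  \<open>actE\<close>, \<open>actB\<close> are the actions on \<open>E\<close> and \<open>B\<close> of the elements of the group \<open>G\<close>.  The notions
  below depend on \<open>G\<close> only through its underlying set and these actions.
\<close>

definition fibre_measures ::
    "'e set \<Rightarrow> 'b topology \<Rightarrow> ('e \<Rightarrow> 'b) \<Rightarrow> nat \<Rightarrow> 'e pmf set" where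
  "fibre_measures E B p k =
     {\<mu> \<in> finsupp_measures E k. \<exists>x \<in> topspace B. set_pmf \<mu> \<subseteq> {e \<in> E. p e = x}}"

definition fibre_projection ::
    "'e set \<Rightarrow> 'b topology \<Rightarrow> ('e \<Rightarrow> 'b) \<Rightarrow> 'e pmf \<Rightarrow> 'b" where
  "fibre_projection E B p \<mu> =
     (THE x. x \<in> topspace B \<and> set_pmf \<mu> \<subseteq> {e \<in> E. p e = x})"

definition equivariant_section ::
    "'g set \<Rightarrow> ('g \<Rightarrow> 'e \<Rightarrow> 'e) \<Rightarrow> 'e set \<Rightarrow> ('e \<Rightarrow> 'e \<Rightarrow> real) \<Rightarrow>
     ('g \<Rightarrow> 'b \<Rightarrow> 'b) \<Rightarrow> 'b topology \<Rightarrow> ('e \<Rightarrow> 'b) \<Rightarrow> nat \<Rightarrow> ('b \<Rightarrow> 'e pmf) \<Rightarrow> bool" where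
  "equivariant_section G actE E d actB B p k s \<longleftrightarrow>
     continuous_map B (subtopology (finsupp_topology E d k) (fibre_measures E B p k)) s \<and>
     (\<forall>x \<in> topspace B. fibre_projection E B p (s x) = x) \<and>
     (\<forall>g \<in> G. \<forall>x \<in> topspace B. s (actB g x) = map_pmf (actE g) (s x))"

text \<open>The value is \<open>\<infinity>\<close> if there is no \<open>n\<close> with an equivariant section.\<close>

definition dsecat ::
    "'g set \<Rightarrow> ('g \<Rightarrow> 'e \<Rightarrow> 'e) \<Rightarrow> 'e set \<Rightarrow> ('e \<Rightarrow> 'e \<Rightarrow> real) \<Rightarrow>
     ('g \<Rightarrow> 'b \<Rightarrow> 'b) \<Rightarrow> 'b topology \<Rightarrow> ('e \<Rightarrow> 'b) \<Rightarrow> enat" where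
  "dsecat G actE E d actB B p =
     Inf (enat ` {n. \<exists>s. equivariant_section G actE E d actB B p (n + 1) s})"

section \<open>Path spaces and equivariant distributional complexity\<close>

text \<open>
  Paths are made extensional outside the unit interval, so that equality of functions is equality
  of paths.
\<close>

definition paths :: "'a topology \<Rightarrow> (real \<Rightarrow> 'a) set" where
  "paths X = {\<phi>. pathin X \<phi> \<and> \<phi> \<in> extensional {0..1}}"

definition path_topology :: "'a topology \<Rightarrow> (real \<Rightarrow> 'a) topology" where
  "path_topology X = topology_generated_by
     {{\<phi> \<in> paths X. \<phi> ` K \<subseteq> U} | K U. compact K \<and> K \<subseteq> {0..1} \<and> openin X U}"

lemma metrizable_path_topology:
  fixes X :: "'a topology"
  assumes "metrizable_space X"
  shows "metrizable_space (path_topology X)"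
proof -
  obtain M d where "Metric_space M d" and X: "X = Metric_space.mtopology M d"
    using assms by (auto simp: metrizable_space_def)
  interpret Metric_space M d by fact
  let ?I = "{0..1::real}"
  have compact_image: "compactin mtopology (\<phi> ` K)" if "\<phi> \<in> paths X" "compact K" "K \<subseteq> ?I" for \<phi> K
    using that unfolding paths_def pathin_def X
    by (auto intro!: image_compactin[of "top_of_set ?I"] simp: compactin_subtopology)
  have sub: "paths X \<subseteq> fspace ?I"
  proof
    fix \<phi> assume \<phi>: "\<phi> \<in> paths X"
    have "compactin mtopology (\<phi> ` ?I)" by (rule compact_image[OF \<phi>]) auto
    then have "mbounded (\<phi> ` ?I)" "\<phi> ` ?I \<subseteq> M"
      using compactin_imp_mbounded compactin_subset_topspace by fastforce+
    then show "\<phi> \<in> fspace ?I" using \<phi> by (simp add: fspace_def paths_def)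
  qed
  interpret F: Metric_space "paths X" "fdist ?I"
    using Metric_space.subspace[OF Metric_space_funspace sub] .
  have le: "d (\<phi> t) (\<psi> t) \<le> fdist ?I \<phi> \<psi>" if "\<phi> \<in> paths X" "\<psi> \<in> paths X" "t \<in> ?I" for \<phi> \<psi> t
    using funspace_mdist_le[of \<phi> ?I \<psi> "fdist ?I \<phi> \<psi>"] that sub by (auto simp: subset_iff)
  let ?S = "{{\<phi> \<in> paths X. \<phi> ` K \<subseteq> U} | K U. compact K \<and> K \<subseteq> ?I \<and> openin X U}"
  have 1: "openin F.mtopology {\<phi> \<in> paths X. \<phi> ` K \<subseteq> U}"
    if K: "compact K" "K \<subseteq> ?I" and U: "openin X U" for K U
    unfolding F.openin_mtopology
  proof (intro conjI allI impI)
    fix \<phi> assume "\<phi> \<in> {\<phi> \<in> paths X. \<phi> ` K \<subseteq> U}"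
    then have \<phi>: "\<phi> \<in> paths X" "\<phi> ` K \<subseteq> U" by auto
    obtain \<epsilon> where \<epsilon>: "\<epsilon> > 0" "\<And>x. x \<in> \<phi> ` K \<Longrightarrow> mball x \<epsilon> \<subseteq> U"
      using lebesgue_number[OF compact_image[OF \<phi>(1) K], of "{U}"] \<phi> U X by auto
    have "\<psi> ` K \<subseteq> U" if "\<psi> \<in> F.mball \<phi> \<epsilon>" for \<psi>
    proof
      fix y assume "y \<in> \<psi> ` K"
      then obtain t where t: "t \<in> K" "y = \<psi> t" by auto
      have \<psi>: "\<psi> \<in> paths X" "fdist ?I \<phi> \<psi> < \<epsilon>" using that by auto
      have "\<phi> t \<in> M" "\<psi> t \<in> M" using fspace_in_M[OF subsetD[OF sub \<phi>(1)]] fspace_in_M[OF subsetD[OF sub \<psi>(1)]] t(1) K(2)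
        by (meson subsetD)+
      then have "\<psi> t \<in> mball (\<phi> t) \<epsilon>" using le[OF \<phi>(1) \<psi>(1), of t] \<psi>(2) t K by auto
      then show "y \<in> U" using \<epsilon>(2)[of "\<phi> t"] t by auto
    qed
    moreover have "F.mball \<phi> \<epsilon> \<subseteq> paths X"
      by auto
    ultimately have "F.mball \<phi> \<epsilon> \<subseteq> {\<phi> \<in> paths X. \<phi> ` K \<subseteq> U}"
      by blast
    then show "\<exists>r>0. F.mball \<phi> r \<subseteq> {\<phi> \<in> paths X. \<phi> ` K \<subseteq> U}"
      using \<epsilon>(1) by blast
  qed auto
  have 2: "\<exists>V. openin (path_topology X) V \<and> \<phi> \<in> V \<and> V \<subseteq> F.mball \<phi> r"
    if \<phi>: "\<phi> \<in> paths X" and r: "r > 0" for \<phi> r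
  proof -
    have cont: "continuous_map (top_of_set ?I) mtopology \<phi>"
      using \<phi> by (simp add: paths_def pathin_def X)
    have inM: "\<phi> t \<in> M" if "t \<in> ?I" for t
      using fspace_in_M[OF subsetD[OF sub \<phi>] that] .
    have "\<exists>\<delta>>0. \<phi> ` (?I \<inter> cball t \<delta>) \<subseteq> mball (\<phi> t) (r/3)" if t: "t \<in> ?I" for t
    proof -
      obtain U where U: "openin (top_of_set ?I) U" "t \<in> U" "\<And>y. y \<in> U \<Longrightarrow> \<phi> y \<in> mball (\<phi> t) (r/3)"
        using cont[unfolded continuous_map_to_metric] t r
        by (metis divide_pos_pos topspace_euclidean_subtopology zero_less_numeral)
      then obtain \<delta> where "\<delta> > 0" "cball t \<delta> \<inter> ?I \<subseteq> U"
        using openin_contains_cball[of ?I U] by auto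
      then show ?thesis using U(3) by (intro exI[of _ \<delta>]) auto
    qed
    then obtain \<delta> where \<delta>: "\<And>t. t \<in> ?I \<Longrightarrow> \<delta> t > 0"
      "\<And>t. t \<in> ?I \<Longrightarrow> \<phi> ` (?I \<inter> cball t (\<delta> t)) \<subseteq> mball (\<phi> t) (r/3)" by metis
    have "?I \<subseteq> (\<Union>t\<in>?I. ball t (\<delta> t))" using \<delta>(1) by force
    then obtain T where T: "T \<subseteq> ?I" "finite T" "?I \<subseteq> (\<Union>t\<in>T. ball t (\<delta> t))"
      using compactE_image[of ?I ?I "\<lambda>t. ball t (\<delta> t)"] compact_Icc by auto
    define W where "W t = {\<psi> \<in> paths X. \<psi> ` (?I \<inter> cball t (\<delta> t)) \<subseteq> mball (\<phi> t) (r/3)}" for t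
    have W: "openin (path_topology X) (W t)" for t
      unfolding path_topology_def
      by (rule topology_generated_by_Basis)
         (auto simp: W_def X intro!: exI[of _ "?I \<inter> cball t (\<delta> t)"] exI[of _ "mball (\<phi> t) (r/3)"]
            compact_Int)
    have ne: "T \<noteq> {}" using T(3) by (metis UN_empty atLeastAtMost_iff empty_iff order_refl subsetD zero_le_one)
    have "openin (path_topology X) (\<Inter>t\<in>T. W t)"
      using T(2) ne W by (intro openin_INT2) auto
    moreover have "\<phi> \<in> (\<Inter>t\<in>T. W t)" 
    proof
      fix t assume "t \<in> T"
      then have "t \<in> ?I" using T(1) by blast
      then show "\<phi> \<in> W t" unfolding W_def using \<delta>(2) \<phi> by blast
    qed
    moreover have "(\<Inter>t\<in>T. W t) \<subseteq> F.mball \<phi> r"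
    proof
      fix \<psi> assume \<psi>: "\<psi> \<in> (\<Inter>t\<in>T. W t)"
      obtain t0 where "t0 \<in> T" using ne by blast
      then have \<psi>p: "\<psi> \<in> paths X" using \<psi> unfolding W_def by blast
      have "d (\<phi> s) (\<psi> s) \<le> 2 * r / 3" if s: "s \<in> ?I" for s
      proof -
        obtain t where t: "t \<in> T" "s \<in> ball t (\<delta> t)" using T(3) s by blast
        then have "s \<in> ?I \<inter> cball t (\<delta> t)" using s by auto
        then have "\<phi> s \<in> mball (\<phi> t) (r/3)" "\<psi> s \<in> mball (\<phi> t) (r/3)"
          using \<psi> t(1) \<delta>(2)[OF subsetD[OF T(1) t(1)]] unfolding W_def by blast+
        then show ?thesis
          using triangle[of "\<phi> s" "\<phi> t" "\<psi> s"] commute[of "\<phi> s" "\<phi> t"]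
          unfolding in_mball by linarith
      qed
      then have "fdist ?I \<phi> \<psi> \<le> 2 * r / 3"
        using funspace_mdist_le[OF subsetD[OF sub \<phi>] subsetD[OF sub \<psi>p], of "2 * r / 3"]
        by simp
      then show "\<psi> \<in> F.mball \<phi> r" using \<phi> \<psi>p r unfolding F.in_mball by linarith
    qed
    ultimately show ?thesis by blast
  qed
  have "path_topology X = F.mtopology"
  proof (rule topology_eq[THEN iffD2], intro allI iffI)
    fix V assume "openin (path_topology X) V"
    then have "generate_topology_on ?S V"
      by (simp add: path_topology_def openin_topology_generated_by_iff)
    then show "openin F.mtopology V"
    proof induction
      case (UN \<K>)
      then show ?case by (intro openin_Union) blast
    next
      case (Basis S)
      then show ?case using 1 by blast
    qed (blast intro: openin_empty openin_Int)+
  next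
    fix V assume V: "openin F.mtopology V"
    show "openin (path_topology X) V"
    proof (subst openin_subopen, intro ballI)
      fix \<phi> assume "\<phi> \<in> V"
      with V obtain r where "r > 0" "F.mball \<phi> r \<subseteq> V" "\<phi> \<in> paths X"
        unfolding F.openin_mtopology by (meson subsetD)
      then show "\<exists>T. openin (path_topology X) T \<and> \<phi> \<in> T \<and> T \<subseteq> V"
        using 2[of \<phi> r] by blast
    qed
  qed
  then show ?thesis
    by (simp only: F.metrizable_space_mtopology)
qed

definition path_action :: "('g \<Rightarrow> 'a \<Rightarrow> 'a) \<Rightarrow> 'g \<Rightarrow> (real \<Rightarrow> 'a) \<Rightarrow> (real \<Rightarrow> 'a)" where
  "path_action act g \<phi> = (\<lambda>t\<in>{0..1}. act g (\<phi> t))"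

definition diagonal_action :: "('g \<Rightarrow> 'a \<Rightarrow> 'a) \<Rightarrow> 'g \<Rightarrow> 'a \<times> 'a \<Rightarrow> 'a \<times> 'a" where
  "diagonal_action act g = (\<lambda>(x, y). (act g x, act g y))"

definition path_endpoints :: "(real \<Rightarrow> 'a) \<Rightarrow> 'a \<times> 'a" where
  "path_endpoints \<phi> = (\<phi> 0, \<phi> 1)"

text \<open>
  The metric \<open>\<rho>\<close> on the path space, from which the Levy-Prokhorov metric is formed, is an explicit
  argument; it is meant to induce the compact-open topology.
\<close>

definition dTC ::
    "'g set \<Rightarrow> ('g \<Rightarrow> 'a \<Rightarrow> 'a) \<Rightarrow> 'a topology \<Rightarrow>
     ((real \<Rightarrow> 'a) \<Rightarrow> (real \<Rightarrow> 'a) \<Rightarrow> real) \<Rightarrow> enat" where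
  "dTC G act X \<rho> =
     dsecat G (path_action act) (paths X) \<rho>
       (diagonal_action act) (prod_topology X X) path_endpoints"

section \<open>Real projective space and the action of the special orthogonal group\<close>

text \<open>The class \<open>[v]\<close> of \<open>v \<noteq> 0\<close> modulo nonzero scalars.\<close>

definition proj_class :: "real ^ 'm \<Rightarrow> (real ^ 'm) set" where
  "proj_class v = {c *\<^sub>R v | c. c \<noteq> 0}"

definition projective_space :: "(real ^ 'm) set topology" where
  "projective_space = topology (\<lambda>U. U \<subseteq> proj_class ` (- {0}) \<and> open {v \<in> - {0}. proj_class v \<in> U})"

lemma openin_projective_space:
  "openin projective_space U \<longleftrightarrow>
     U \<subseteq> proj_class ` (- {0}) \<and> open {v \<in> - {0}. proj_class v \<in> U}"
proof -
  have "istopology (\<lambda>U. U \<subseteq> proj_class ` (- {0::real ^ 'm}) \<and> open {v \<in> - {0}. proj_class v \<in> U})"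
    unfolding istopology_def
  proof (intro conjI allI impI; (elim conjE)?)
    fix S T :: "(real ^ 'm) set set"
    assume "open {v \<in> - {0}. proj_class v \<in> S}" "open {v \<in> - {0}. proj_class v \<in> T}"
    then have "open ({v \<in> - {0}. proj_class v \<in> S} \<inter> {v \<in> - {0}. proj_class v \<in> T})"
      by (rule open_Int)
    then show "open {v \<in> - {0}. proj_class v \<in> S \<inter> T}"
      by (rule back_subst[where P = "open"]) auto
  next
    fix \<K> :: "(real ^ 'm) set set set"
    assume "\<forall>K\<in>\<K>. K \<subseteq> proj_class ` (- {0}) \<and> open {v \<in> - {0}. proj_class v \<in> K}"
    then have "open (\<Union>K\<in>\<K>. {v \<in> - {0}. proj_class v \<in> K})"
      by auto
    then show "open {v \<in> - {0}. proj_class v \<in> \<Union>\<K>}"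
      by (rule back_subst[where P = "open"]) auto
  qed auto
  then show ?thesis
    unfolding projective_space_def by (rule fun_cong[OF topology_inverse'])
qed

lemma quotient_map_proj_class: "quotient_map (top_of_set (- {0})) projective_space proj_class"
proof -
  have "openin projective_space (proj_class ` (- {0 :: real ^ 'm}))"
    by (auto simp: openin_projective_space intro!: back_subst[where P = "open", OF open_delete[OF open_UNIV, of 0]])
  then have "topspace (projective_space :: (real ^ 'm) set topology) = proj_class ` (- {0})"
    by (meson openin_projective_space openin_subset openin_topspace subset_antisym)
  then show ?thesis
    by (auto simp: quotient_map_def openin_projective_space openin_open_eq[OF open_Compl[OF closed_singleton]])
qed

lemma metrizable_projective_space: "metrizable_space (projective_space :: (real ^ 'm) set topology)"
proof -
  define P :: "real ^ 'm \<Rightarrow> real ^ 'm ^ 'm" where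
    "P v = (\<chi> i j. v $ i * v $ j / (v \<bullet> v))" for v
  have P_scale: "P (c *\<^sub>R v) = P v" if "c \<noteq> 0" for c v
    using that by (simp add: P_def vec_eq_iff)
  have P_inj: "proj_class v = proj_class w" if "P v = P w" and nz: "v \<noteq> 0" "w \<noteq> 0" for v w
  proof -
    have eq: "v $ i * v $ j / (v \<bullet> v) = w $ i * w $ j / (w \<bullet> w)" for i j
      using that(1) by (simp add: P_def vec_eq_iff)
    obtain j where j: "v $ j \<noteq> 0" using nz(1) by (auto simp: vec_eq_iff)
    define c where "c = (v \<bullet> v) * w $ j / (v $ j * (w \<bullet> w))"
    have "v $ i = c * w $ i" for i
      using eq[of i j] nz j by (simp add: c_def field_simps)
    then have vw: "v = c *\<^sub>R w" by (simp add: vec_eq_iff)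
    then have c: "c \<noteq> 0" using nz by auto
    show ?thesis
    proof (intro equalityI subsetI)
      fix x assume "x \<in> proj_class v"
      then show "x \<in> proj_class w" using c by (auto simp: proj_class_def vw)
    next
      fix x assume "x \<in> proj_class w"
      then obtain b where "b \<noteq> 0" "x = b *\<^sub>R w" by (auto simp: proj_class_def)
      then show "x \<in> proj_class v" using c
        by (auto simp: proj_class_def vw intro!: exI[of _ "b / c"])
    qed
  qed
  define f where "f L = P (SOME v. v \<in> L)" for L
  have f: "f (proj_class v) = P v" for v
  proof -
    have "v \<in> proj_class v" by (auto simp: proj_class_def intro!: exI[of _ 1])
    then have "(SOME u. u \<in> proj_class v) \<in> proj_class v" by (rule someI)
    then show ?thesis unfolding f_def by (auto simp: proj_class_def P_scale)
  qed
  let ?RP = "projective_space :: (real ^ 'm) set topology"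
  have top: "topspace ?RP = proj_class ` (- {0})"
    using quotient_map_proj_class[where 'a='m] by (simp add: quotient_map_def)
  have contP: "continuous_on (- {0}) P"
    unfolding P_def by (intro continuous_intros) auto
  have contf: "continuous_map ?RP euclidean f"
    by (rule continuous_compose_quotient_map[OF quotient_map_proj_class])
       (simp add: o_def f contP)
  have contq: "continuous_map (top_of_set (- {0 :: real^'m})) ?RP proj_class"
    by (rule quotient_imp_continuous_map[OF quotient_map_proj_class])
  have sph: "proj_class ` sphere 0 1 = topspace ?RP"
  proof -
    have "proj_class v \<in> proj_class ` sphere 0 1" if "v \<noteq> 0" for v :: "real^'m"
    proof -
      have "P ((1 / norm v) *\<^sub>R v) = P v" using that by (intro P_scale) auto
      then have "proj_class ((1 / norm v) *\<^sub>R v) = proj_class v" using that by (intro P_inj) auto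
      moreover have "(1 / norm v) *\<^sub>R v \<in> sphere 0 1" using that by simp
      ultimately show ?thesis by (metis imageI)
    qed
    then show ?thesis unfolding top by auto
  qed
  have "compactin ?RP (proj_class ` sphere 0 1)"
    by (rule image_compactin[OF _ contq]) (auto simp: compactin_subtopology)
  then have "compact_space ?RP" by (simp add: compact_space_def sph)
  moreover have "inj_on f (topspace ?RP)"
  proof (rule inj_onI)
    fix L L' assume "L \<in> topspace ?RP" "L' \<in> topspace ?RP" and eq: "f L = f L'"
    then obtain v w where vw: "L = proj_class v" "v \<noteq> 0" "L' = proj_class w" "w \<noteq> 0"
      unfolding top by blast
    with eq show "L = L'"
      using P_inj[of v w] by (simp add: f)
  qed
  ultimately have "embedding_map ?RP euclidean f"
    using contf by (intro continuous_imp_embedding_map Hausdorff_space_euclidean)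
  then show ?thesis
    using embedding_map_imp_homeomorphic_space homeomorphic_metrizable_space
      metrizable_space_subtopology metrizable_space_euclidean by blast
qed

lemma topspace_path_topology [simp]: "topspace (path_topology X) = paths X"
proof -
  let ?S = "{{\<phi> \<in> paths X. \<phi> ` K \<subseteq> U} | K U. compact K \<and> K \<subseteq> {0..1} \<and> openin X U}"
  have "\<exists>K U. paths X = {\<phi> \<in> paths X. \<phi> ` K \<subseteq> U} \<and> compact K \<and> K \<subseteq> {0..1} \<and> openin X U"
    by (rule exI[of _ "{}"], rule exI[of _ "{}"]) simp
  then have "paths X \<in> ?S"
    by (rule CollectI)
  moreover have "A \<subseteq> paths X" if "A \<in> ?S" for A
    using that by (elim CollectE exE conjE) (simp only: Collect_subset Collect_conj_eq Collect_mem_eq Int_lower1)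
  ultimately have "\<Union> ?S = paths X"
    by (intro equalityI Union_least Union_upper)
  then show ?thesis
    by (simp only: path_topology_def topology_generated_by_topspace)
qed

text \<open>The path space of projective space does carry a metric inducing its topology.\<close>

lemma ex_path_metric_projective_space:
  fixes X :: "(real ^ 'm) set topology"
  defines "X \<equiv> projective_space"
  shows "\<exists>\<rho>. Metric_space (paths X) \<rho> \<and> Metric_space.mtopology (paths X) \<rho> = path_topology X"
proof -
  have "metrizable_space (path_topology X)"
    unfolding X_def by (intro metrizable_path_topology metrizable_projective_space)
  then obtain M \<rho> where M: "Metric_space M \<rho>" "path_topology X = Metric_space.mtopology M \<rho>"
    by (auto simp: metrizable_space_def)
  then have "M = paths X"
    by (metis Metric_space.topspace_mtopology topspace_path_topology)
  with M show ?thesis by auto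
qed

text \<open>
  With \<open>CARD('n) = n\<close>, Euclidean space of dimension \<open>n + 1\<close> is \<^typ>\<open>real ^ 'n option\<close>, where the
  index \<^const>\<open>None\<close> stands for the last coordinate.
\<close>

definition special_orthogonal :: "(real ^ 'n ^ 'n) set" where
  "special_orthogonal = {A. rotation_matrix A}"

definition block_embedding :: "real ^ 'n ^ 'n \<Rightarrow> real ^ 'n option ^ 'n option" where
  "block_embedding A = (\<chi> i j. case (i, j) of
       (Some a, Some b) \<Rightarrow> A $ a $ b
     | (None, None) \<Rightarrow> 1
     | _ \<Rightarrow> 0)"

definition projective_action ::
    "real ^ 'n ^ 'n \<Rightarrow> (real ^ 'n option) set \<Rightarrow> (real ^ 'n option) set" where
  "projective_action A L = (\<lambda>v. block_embedding A *v v) ` L"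

lemma projective_action_proj_class:
  "projective_action A (proj_class v) = proj_class (block_embedding A *v v)"
proof (intro equalityI subsetI)
  fix w assume "w \<in> proj_class (block_embedding A *v v)"
  then obtain c where "c \<noteq> 0" "w = block_embedding A *v (c *\<^sub>R v)"
    by (auto simp: proj_class_def matrix_vector_mult_scaleR)
  then show "w \<in> projective_action A (proj_class v)"
    by (auto simp: projective_action_def proj_class_def)
qed (auto simp: projective_action_def proj_class_def matrix_vector_mult_scaleR)

end

theory Submission
  imports Defs
begin

text \<open>
  Let \<open>v\<close>, \<open>w\<close> be unit vectors spanning two given lines.  The straight segments from \<open>v\<close> to \<open>w\<close> and
  from \<open>v\<close> to \<open>- w\<close> project to paths between these lines, which get the weights \<open>(1 + v \<bullet> w) / 2\<close>
  and \<open>(1 - v \<bullet> w) / 2\<close>.  A segment runs through \<open>0\<close> only if its weight vanishes, changing the sign of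
  \<open>v\<close> or \<open>w\<close> swaps the two weighted paths, and all orthogonal maps are respected; this gives an
  equivariant section by measures with at most two atoms.  A section by Dirac measures is
  a continuous choice of paths, which would contract projective space.
\<close>

section \<open>The Levy-Prokhorov metric\<close>

text \<open>Unit representatives of lines cannot be chosen continuously, so the section uses
  arbitrary ones, and its continuity is tested on pairs of unit vectors, where the formula is
  explicit. A gap remains even there: for \<open>v = - w\<close> the first segment meets 0 and
  yields no path, and for \<open>v = w\<close> the second one does. The Levy-Prokhorov metric
  forgives this, because mass at most \<open>\<epsilon>\<close> may jump anywhere at cost
  \<open>\<epsilon>\<close>; each branch therefore has to be continuous only where its weight is
  positive. On Dirac measures the same metric is rigid: below distance 1 it controls the distance of
  the two points, which turns a section with one atom into a continuous map to the path space. The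
  resulting contraction is refuted by lifting it to the sphere, a connected double cover.\<close>

definition lp_close :: "'e set \<Rightarrow> ('e \<Rightarrow> 'e \<Rightarrow> real) \<Rightarrow> real \<Rightarrow> 'e pmf \<Rightarrow> 'e pmf \<Rightarrow> bool" where
  "lp_close M d \<epsilon> \<mu> \<nu> \<longleftrightarrow> \<epsilon> > 0 \<and> (\<forall>A \<in> borel_subsets M d.
     measure_pmf.prob \<mu> A \<le> measure_pmf.prob \<nu> (thickening M d \<epsilon> A) + \<epsilon> \<and>
     measure_pmf.prob \<nu> A \<le> measure_pmf.prob \<mu> (thickening M d \<epsilon> A) + \<epsilon>)"

lemma levy_prokhorov_eq_Inf: "levy_prokhorov M d \<mu> \<nu> = Inf {\<epsilon>. lp_close M d \<epsilon> \<mu> \<nu>}"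
  by (simp add: levy_prokhorov_def lp_close_def)

lemma lp_close_sym: "lp_close M d \<epsilon> \<mu> \<nu> \<Longrightarrow> lp_close M d \<epsilon> \<nu> \<mu>"
  by (auto simp: lp_close_def)

lemma lp_close_mono:
  assumes "lp_close M d \<epsilon> \<mu> \<nu>" "\<epsilon> \<le> \<delta>"
  shows "lp_close M d \<delta> \<mu> \<nu>"
proof -
  have "measure_pmf.prob \<xi> (thickening M d \<epsilon> A) \<le> measure_pmf.prob \<xi> (thickening M d \<delta> A)" for \<xi> A
    using assms(2) by (intro measure_pmf.finite_measure_mono) (force simp: thickening_def)+
  with assms show ?thesis
    unfolding lp_close_def by (smt (verit))
qed

lemma lp_close_one: "lp_close M d 1 \<mu> \<nu>"
  unfolding lp_close_def by (smt (verit) measure_nonneg measure_pmf.prob_le_1)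

lemma levy_prokhorov_le: "lp_close M d \<epsilon> \<mu> \<nu> \<Longrightarrow> levy_prokhorov M d \<mu> \<nu> \<le> \<epsilon>"
  unfolding levy_prokhorov_eq_Inf by (intro cInf_lower) (auto simp: lp_close_def intro!: bdd_belowI[of _ 0])

text \<open>The admissible \<open>\<epsilon>\<close> are closed upwards, so every number above the
  infimum is admissible. The infimum itself need not be: for equal measures on \<open>M\<close> it
  is 0, whereas \<open>lp_close\<close> demands \<open>\<epsilon> > 0\<close>.\<close>

lemma lp_close_if_levy_prokhorov_less:
  assumes "levy_prokhorov M d \<mu> \<nu> < \<epsilon>"
  shows "lp_close M d \<epsilon> \<mu> \<nu>"
proof -
  obtain \<delta> where "lp_close M d \<delta> \<mu> \<nu>" "\<delta> < \<epsilon>"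
    using cInf_lessD[of "{\<epsilon>. lp_close M d \<epsilon> \<mu> \<nu>}" \<epsilon>] assms lp_close_one[of M d \<mu> \<nu>]
    unfolding levy_prokhorov_eq_Inf by blast
  then show ?thesis
    by (auto intro: lp_close_mono)
qed

lemma levy_prokhorov_nonneg: "0 \<le> levy_prokhorov M d \<mu> \<nu>"
  unfolding levy_prokhorov_eq_Inf using lp_close_one[of M d \<mu> \<nu>]
  by (intro cInf_greatest) (blast, simp add: lp_close_def)

lemma levy_prokhorov_sym: "levy_prokhorov M d \<mu> \<nu> = levy_prokhorov M d \<nu> \<mu>"
  unfolding levy_prokhorov_eq_Inf by (metis lp_close_sym)

section \<open>Metric axioms for finitely supported measures; Dirac measures\<close>

context Metric_space
begin

lemma borel_subsets_subset: "A \<in> borel_subsets M d \<Longrightarrow> A \<subseteq> M"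
  unfolding borel_subsets_def by (rule sigma_sets_into_sp[rotated]) (auto simp: openin_mtopology)

lemma openin_thickening:
  assumes "A \<subseteq> M"
  shows "openin mtopology (thickening M d \<epsilon> A)"
proof -
  have "thickening M d \<epsilon> A = (\<Union>a\<in>A. mball a \<epsilon>)"
    using assms by (force simp: thickening_def)
  then show ?thesis
    by auto
qed

text \<open>The metric tests Borel sets only, and the triangle inequality applies its second
  comparison to a thickening; openness makes that legitimate.\<close>

lemma thickening_in_borel_subsets:
  "A \<subseteq> M \<Longrightarrow> thickening M d \<epsilon> A \<in> borel_subsets M d"
  unfolding borel_subsets_def by (intro sigma_sets.Basic) (auto simp: openin_thickening)

lemma singleton_in_borel_subsets:
  assumes "x \<in> M"
  shows "{x} \<in> borel_subsets M d"
proof -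
  have "openin mtopology (M - {x})"
    using assms closedin_Hausdorff_singleton[OF Hausdorff_space_mtopology, of x]
    by (simp add: closedin_def)
  then have "M - (M - {x}) \<in> borel_subsets M d"
    unfolding borel_subsets_def by (intro sigma_sets.Compl sigma_sets.Basic) auto
  then show ?thesis
    using assms by (simp add: double_diff)
qed

lemma thickening_thickening_subset:
  "A \<subseteq> M \<Longrightarrow> thickening M d \<delta> (thickening M d \<epsilon> A) \<subseteq> thickening M d (\<epsilon> + \<delta>) A"
  unfolding thickening_def by clarsimp (smt (verit) subsetD triangle)

lemma lp_close_trans:
  assumes "lp_close M d \<epsilon> \<mu> \<nu>" "lp_close M d \<delta> \<nu> \<xi>"
  shows "lp_close M d (\<epsilon> + \<delta>) \<mu> \<xi>"
proof -
  \<comment> \<open>Measures and radii are generalised because the other inequality is this one for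
    the reversed chain from \<open>\<xi>\<close> to \<open>\<mu>\<close>.\<close>
  have half: "measure_pmf.prob \<mu> A \<le> measure_pmf.prob \<xi> (thickening M d (\<epsilon> + \<delta>) A) + (\<epsilon> + \<delta>)"
    if A: "A \<in> borel_subsets M d" and close: "lp_close M d \<epsilon> \<mu> \<nu>" "lp_close M d \<delta> \<nu> \<xi>"
    for A \<mu> \<xi> \<epsilon> \<delta>
  proof -
    have "A \<subseteq> M"
      by (rule borel_subsets_subset[OF A])
    have "measure_pmf.prob \<mu> A \<le> measure_pmf.prob \<nu> (thickening M d \<epsilon> A) + \<epsilon>"
      using A close(1) by (simp add: lp_close_def)
    also have "measure_pmf.prob \<nu> (thickening M d \<epsilon> A)
        \<le> measure_pmf.prob \<xi> (thickening M d \<delta> (thickening M d \<epsilon> A)) + \<delta>"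
      using close(2) thickening_in_borel_subsets[OF \<open>A \<subseteq> M\<close>] by (simp add: lp_close_def)
    also have "measure_pmf.prob \<xi> (thickening M d \<delta> (thickening M d \<epsilon> A))
        \<le> measure_pmf.prob \<xi> (thickening M d (\<epsilon> + \<delta>) A)"
      by (rule measure_pmf.finite_measure_mono[OF thickening_thickening_subset[OF \<open>A \<subseteq> M\<close>]]) simp
    finally show ?thesis
      by simp
  qed
  show ?thesis
    using half[OF _ assms] half[OF _ lp_close_sym[OF assms(2)] lp_close_sym[OF assms(1)]] assms
    by (simp add: lp_close_def add.commute)
qed

lemma levy_prokhorov_triangle:
  "levy_prokhorov M d \<mu> \<xi> \<le> levy_prokhorov M d \<mu> \<nu> + levy_prokhorov M d \<nu> \<xi>"
proof (rule field_le_epsilon)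
  fix e :: real
  assume "e > 0"
  then have "lp_close M d (levy_prokhorov M d \<mu> \<nu> + e/2) \<mu> \<nu>"
    "lp_close M d (levy_prokhorov M d \<nu> \<xi> + e/2) \<nu> \<xi>"
    by (auto intro: lp_close_if_levy_prokhorov_less)
  from levy_prokhorov_le[OF lp_close_trans[OF this]]
  show "levy_prokhorov M d \<mu> \<xi> \<le> levy_prokhorov M d \<mu> \<nu> + levy_prokhorov M d \<nu> \<xi> + e"
    by simp
qed

lemma levy_prokhorov_refl:
  assumes "set_pmf \<mu> \<subseteq> M"
  shows "levy_prokhorov M d \<mu> \<mu> = 0"
proof -
  have "levy_prokhorov M d \<mu> \<mu> \<le> e" if "e > 0" for e
  proof (rule levy_prokhorov_le)
    have "measure_pmf.prob \<mu> A \<le> measure_pmf.prob \<mu> (thickening M d e A)" for A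
    proof -
      \<comment> \<open>\<open>A\<close> may leave \<open>M\<close>, but thickenings consist of
        points of \<open>M\<close>; the part of \<open>A\<close> inside the support lies in
        \<open>M\<close> and has distance 0 from \<open>A\<close>.\<close>
      have "measure_pmf.prob \<mu> A = measure_pmf.prob \<mu> (A \<inter> set_pmf \<mu>)"
        by (rule measure_Int_set_pmf[symmetric])
      also have "\<dots> \<le> measure_pmf.prob \<mu> (thickening M d e A)"
        using assms \<open>e > 0\<close> by (intro measure_pmf.finite_measure_mono) (force simp: thickening_def)+
      finally show ?thesis .
    qed
    with \<open>e > 0\<close> show "lp_close M d e \<mu> \<mu>"
      by (smt (verit) lp_close_def)
  qed
  then show ?thesis
    using levy_prokhorov_nonneg[of M d \<mu> \<mu>] by (metis antisym field_le_epsilon add_0)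
qed

text \<open>As \<open>\<nu>\<close> has finite support, some ball around \<open>x\<close> contains
  no other atom of \<open>\<nu>\<close>, so a small thickening of \<open>{x}\<close> gains no
  further mass. Exchanging the measures gives equality.\<close>

lemma pmf_le_if_levy_prokhorov_eq_0:
  assumes "levy_prokhorov M d \<mu> \<nu> = 0" "x \<in> M" and \<nu>: "set_pmf \<nu> \<subseteq> M" "finite (set_pmf \<nu>)"
  shows "pmf \<mu> x \<le> pmf \<nu> x"
proof (rule field_le_epsilon)
  fix e :: real
  assume "e > 0"
  obtain r where r: "r > 0" "\<And>y. y \<in> set_pmf \<nu> - {x} \<Longrightarrow> r \<le> d x y"
  proof
    \<comment> \<open>The element 1 keeps the minimum defined when \<open>\<nu>\<close> has no atom
      other than \<open>x\<close>.\<close>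
    show "Min (insert 1 (d x ` (set_pmf \<nu> - {x}))) > 0"
      using \<nu> \<open>x \<in> M\<close> by (subst Min_gr_iff) auto
    show "Min (insert 1 (d x ` (set_pmf \<nu> - {x}))) \<le> d x y" if "y \<in> set_pmf \<nu> - {x}" for y
      using \<nu> that by (intro Min_le) auto
  qed
  define \<delta> where "\<delta> = min e r"
  have "lp_close M d \<delta> \<mu> \<nu>"
    using \<open>e > 0\<close> r(1) assms(1) by (intro lp_close_if_levy_prokhorov_less) (simp add: \<delta>_def)
  then have "measure_pmf.prob \<mu> {x} \<le> measure_pmf.prob \<nu> (thickening M d \<delta> {x}) + \<delta>"
    using singleton_in_borel_subsets[OF \<open>x \<in> M\<close>] by (simp add: lp_close_def)
  also have "measure_pmf.prob \<nu> (thickening M d \<delta> {x})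
      = measure_pmf.prob \<nu> (thickening M d \<delta> {x} \<inter> set_pmf \<nu>)"
    by (rule measure_Int_set_pmf[symmetric])
  also have "\<dots> \<le> measure_pmf.prob \<nu> {x}"
    using r(2) by (intro measure_pmf.finite_measure_mono) (fastforce simp: thickening_def \<delta>_def)+
  finally show "pmf \<mu> x \<le> pmf \<nu> x + e"
    by (simp add: measure_pmf_single \<delta>_def)
qed

lemma Metric_space_levy_prokhorov:
  "Metric_space (finsupp_measures M k) (levy_prokhorov M d)"
proof
  fix \<mu> \<nu>
  assume "\<mu> \<in> finsupp_measures M k" "\<nu> \<in> finsupp_measures M k"
  then have *: "set_pmf \<mu> \<subseteq> M" "finite (set_pmf \<mu>)" "set_pmf \<nu> \<subseteq> M" "finite (set_pmf \<nu>)"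
    by (auto simp: finsupp_measures_def)
  show "levy_prokhorov M d \<mu> \<nu> = 0 \<longleftrightarrow> \<mu> = \<nu>"
  proof
    assume eq: "levy_prokhorov M d \<mu> \<nu> = 0"
    show "\<mu> = \<nu>"
    proof (rule pmf_eqI)
      fix x
      show "pmf \<mu> x = pmf \<nu> x"
      proof (cases "x \<in> M")
        case True
        with eq * show ?thesis
          by (intro antisym pmf_le_if_levy_prokhorov_eq_0) (auto simp: levy_prokhorov_sym[of M d \<nu> \<mu>])
      next
        case False
        with * show ?thesis
          by (metis pmf_eq_0_set_pmf subsetD)
      qed
    qed
  qed (use * levy_prokhorov_refl in auto)
qed (auto simp: levy_prokhorov_nonneg levy_prokhorov_triangle intro: levy_prokhorov_sym)

lemma topspace_finsupp_topology [simp]: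
  "topspace (finsupp_topology M d k) = finsupp_measures M k"
  unfolding finsupp_topology_def
  by (rule Metric_space.topspace_mtopology[OF Metric_space_levy_prokhorov])

text \<open>Were \<open>f y\<close> outside the \<open>\<delta>\<close>-thickening of
  \<open>{f x}\<close>, the mass 1 at \<open>f x\<close> would be at most \<open>\<delta>\<close>.
  For \<open>\<delta> < 1\<close>, closeness of Dirac measures is thus closeness of their
  points.\<close>

lemma continuous_map_dirac:
  assumes cont: "continuous_map X (finsupp_topology M d k) (\<lambda>x. return_pmf (f x))"
    and f: "f \<in> topspace X \<rightarrow> M"
  shows "continuous_map X mtopology f"
  unfolding continuous_map_to_metric
proof (intro ballI allI impI)
  fix x and \<epsilon> :: real
  assume x: "x \<in> topspace X" and "\<epsilon> > 0"
  interpret L: Metric_space "finsupp_measures M k" "levy_prokhorov M d"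
    by (rule Metric_space_levy_prokhorov)
  \<comment> \<open>Any cap below 1 would do: the error term alone must not account for the full
    mass.\<close>
  define \<delta> where "\<delta> = min \<epsilon> (1/2)"
  have \<delta>: "0 < \<delta>" "\<delta> < 1" "\<delta> \<le> \<epsilon>"
    using \<open>\<epsilon> > 0\<close> by (auto simp: \<delta>_def)
  obtain U where U: "openin X U" "x \<in> U"
    "\<And>y. y \<in> U \<Longrightarrow> levy_prokhorov M d (return_pmf (f x)) (return_pmf (f y)) < \<delta>"
    using cont[unfolded finsupp_topology_def L.continuous_map_to_metric] x \<delta>(1)
    by (metis L.in_mball)
  have "f y \<in> mball (f x) \<epsilon>" if y: "y \<in> U" for y
  proof -
    have in_M: "f x \<in> M" "f y \<in> M"
      using f x y openin_subset[OF U(1)] by auto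
    have "lp_close M d \<delta> (return_pmf (f x)) (return_pmf (f y))"
      using U(3)[OF y] by (rule lp_close_if_levy_prokhorov_less)
    then have "measure_pmf.prob (return_pmf (f x)) {f x}
        \<le> measure_pmf.prob (return_pmf (f y)) (thickening M d \<delta> {f x}) + \<delta>"
      using singleton_in_borel_subsets[OF in_M(1)] unfolding lp_close_def by blast
    then have "f y \<in> thickening M d \<delta> {f x}"
      using \<delta>(2) by (cases "f y \<in> thickening M d \<delta> {f x}") simp_all
    then show ?thesis
      using in_M \<delta>(3) by (simp add: thickening_def)
  qed
  with U(1,2) show "\<exists>U. openin X U \<and> x \<in> U \<and> (\<forall>y\<in>U. f y \<in> mball (f x) \<epsilon>)"
    by blast
qed

end

section \<open>Measures with at most two atoms\<close>

text \<open>A convex combination of two Dirac measures. As an image of a Bernoulli measure it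
  ignores the point of weight 0 altogether, so an arbitrary value may be supplied there.\<close>

definition mix_pmf :: "real \<Rightarrow> 'e \<Rightarrow> 'e \<Rightarrow> 'e pmf" where
  "mix_pmf a x y = map_pmf (\<lambda>b. if b then x else y) (bernoulli_pmf a)"

lemma bernoulli_pmf_0: "bernoulli_pmf 0 = return_pmf False"
  by (rule pmf_eqI) (case_tac i; simp)

lemma bernoulli_pmf_1: "bernoulli_pmf 1 = return_pmf True"
  by (rule pmf_eqI) (case_tac i; simp)

lemma mix_pmf_0 [simp]: "mix_pmf 0 x y = return_pmf y"
  by (simp add: mix_pmf_def bernoulli_pmf_0)

lemma mix_pmf_1 [simp]: "mix_pmf 1 x y = return_pmf x"
  by (simp add: mix_pmf_def bernoulli_pmf_1)

lemma set_mix_pmf: "0 < a \<Longrightarrow> a < 1 \<Longrightarrow> set_pmf (mix_pmf a x y) = {x, y}"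
  by (auto simp: mix_pmf_def UNIV_bool)

lemma map_mix_pmf: "map_pmf h (mix_pmf a x y) = mix_pmf a (h x) (h y)"
  by (simp add: mix_pmf_def pmf.map_comp o_def if_distrib)

lemma prob_mix_pmf:
  assumes "0 \<le> a" "a \<le> 1"
  shows "measure_pmf.prob (mix_pmf a x y) A = a * indicator A x + (1 - a) * indicator A y"
proof -
  have "measure_pmf.prob (mix_pmf a x y) A = measure_pmf.expectation (mix_pmf a x y) (indicator A)"
    by simp
  also have "\<dots> = measure_pmf.expectation (bernoulli_pmf a) (\<lambda>b. indicator A (if b then x else y))"
    by (simp only: mix_pmf_def integral_map_pmf)
  finally show ?thesis
    using assms by (simp add: algebra_simps)
qed

lemma mix_pmf_swap:
  assumes "0 \<le> a" "a \<le> 1"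
  shows "mix_pmf (1 - a) x y = mix_pmf a y x"
proof (rule pmf_eqI)
  fix z
  show "pmf (mix_pmf (1 - a) x y) z = pmf (mix_pmf a y x) z"
    using assms prob_mix_pmf[of "1 - a" x y "{z}"] prob_mix_pmf[of a y x "{z}"]
    by (simp add: measure_pmf_single)
qed

context Metric_space
begin

lemma mix_pmf_in_finsupp_measures:
  assumes "0 \<le> a" "a \<le> 1" "a > 0 \<Longrightarrow> x \<in> M" "a < 1 \<Longrightarrow> y \<in> M"
  shows "mix_pmf a x y \<in> finsupp_measures M 2"
proof -
  consider "a = 0" | "a = 1" | "0 < a" "a < 1"
    using assms(1,2) by linarith
  then show ?thesis
    by cases (use assms(3,4) in \<open>auto simp: finsupp_measures_def set_mix_pmf card_insert_if\<close>)
qed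

text \<open>If one of the two weights of an atom is 0, the other is at most
  \<open>\<epsilon>\<close>, and that much mass is absorbed by the error term wherever it sits. Only
  atoms charged by both measures have to be close.\<close>

lemma lp_close_mix_pmf:
  assumes "0 \<le> a" "a \<le> 1" "0 \<le> b" "b \<le> 1" "\<bar>a - b\<bar> \<le> \<epsilon>" "\<epsilon> > 0"
    and x: "a = 0 \<or> b = 0 \<or> x \<in> M \<and> x' \<in> M \<and> d x x' < \<epsilon>"
    and y: "a = 1 \<or> b = 1 \<or> y \<in> M \<and> y' \<in> M \<and> d y y' < \<epsilon>"
  shows "lp_close M d \<epsilon> (mix_pmf a x y) (mix_pmf b x' y')"
proof -
  have half: "measure_pmf.prob (mix_pmf a x y) A
      \<le> measure_pmf.prob (mix_pmf b x' y') (thickening M d \<epsilon> A) + \<epsilon>"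
    if "0 \<le> a" "a \<le> 1" "0 \<le> b" "b \<le> 1" "\<bar>a - b\<bar> \<le> \<epsilon>"
      and x: "a = 0 \<or> b = 0 \<or> x \<in> M \<and> x' \<in> M \<and> d x x' < \<epsilon>"
      and y: "a = 1 \<or> b = 1 \<or> y \<in> M \<and> y' \<in> M \<and> d y y' < \<epsilon>" for A a b x y x' y'
  proof -
    \<comment> \<open>With the indicators replaced by numbers 0 or 1, only linear arithmetic in
      \<open>a\<close> and \<open>b\<close> is left.\<close>
    define i j i' j' :: real where "i = indicator A x" and "j = indicator A y"
      and "i' = indicator (thickening M d \<epsilon> A) x'" and "j' = indicator (thickening M d \<epsilon> A) y'"
    have "i \<in> {0, 1}" "j \<in> {0, 1}" "i' \<in> {0, 1}" "j' \<in> {0, 1}"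
      by (auto simp: i_def j_def i'_def j'_def indicator_def)
    moreover have "a = 0 \<or> b = 0 \<or> i \<le> i'"
      using x by (auto simp: i_def i'_def indicator_def thickening_def)
    moreover have "a = 1 \<or> b = 1 \<or> j \<le> j'"
      using y by (auto simp: j_def j'_def indicator_def thickening_def)
    ultimately have "a * i + (1 - a) * j \<le> b * i' + (1 - b) * j' + \<epsilon>"
      using that(1-5) \<open>\<epsilon> > 0\<close> by auto
    then show ?thesis
      using that(1-4) by (simp add: prob_mix_pmf i_def j_def i'_def j'_def)
  qed
  have "measure_pmf.prob (mix_pmf b x' y') A
      \<le> measure_pmf.prob (mix_pmf a x y) (thickening M d \<epsilon> A) + \<epsilon>" for A
    using assms by (intro half) (auto simp: commute)
  with half[OF assms(1-5) x y] \<open>\<epsilon> > 0\<close> show ?thesis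
    by (auto simp: lp_close_def)
qed

text \<open>Where \<open>a\<close> vanishes, nothing is asked of \<open>f\<close>, not even a value
  in \<open>M\<close>; likewise for \<open>g\<close> where \<open>a\<close> is 1. This covers
  segments that run through 0.\<close>

lemma continuous_map_mix_pmf:
  assumes a: "continuous_map X euclideanreal a" "\<And>x. x \<in> topspace X \<Longrightarrow> 0 \<le> a x \<and> a x \<le> 1"
    and f: "continuous_map (subtopology X {x. a x > 0}) mtopology f"
    and g: "continuous_map (subtopology X {x. a x < 1}) mtopology g"
  shows "continuous_map X (finsupp_topology M d 2) (\<lambda>x. mix_pmf (a x) (f x) (g x))"
proof -
  interpret L: Metric_space "finsupp_measures M 2" "levy_prokhorov M d"
    by (rule Metric_space_levy_prokhorov)
  have fM: "f x \<in> M" if "x \<in> topspace X" "a x > 0" for x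
    using continuous_map_funspace[OF f] that by auto
  have gM: "g x \<in> M" if "x \<in> topspace X" "a x < 1" for x
    using continuous_map_funspace[OF g] that by auto
  have mix_in: "mix_pmf (a x) (f x) (g x) \<in> finsupp_measures M 2" if "x \<in> topspace X" for x
    using a(2)[OF that] fM gM that by (intro mix_pmf_in_finsupp_measures) auto
  have near: "\<exists>U. openin X U \<and> x \<in> U \<and> (\<forall>y\<in>U. S y \<longrightarrow> h y \<in> mball (h x) e)"
    if h: "continuous_map (subtopology X {x. S x}) mtopology h" and open_S: "openin X {x \<in> topspace X. S x}"
      and x: "x \<in> topspace X" "S x" and e: "e > 0" for h S x e
  proof -
    obtain V where V: "openin (subtopology X {x. S x}) V" "x \<in> V" "\<forall>y\<in>V. h y \<in> mball (h x) e"
      using h x e unfolding continuous_map_to_metric by (metis IntI mem_Collect_eq topspace_subtopology)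
    then obtain U where "openin X U" "V = U \<inter> {x. S x}"
      by (auto simp: openin_subtopology)
    with V show ?thesis
      by (intro exI[of _ U]) auto
  qed
  show ?thesis
    unfolding finsupp_topology_def L.continuous_map_to_metric
  proof (intro ballI allI impI)
    fix x and e :: real
    assume x: "x \<in> topspace X" and "e > 0"
    \<comment> \<open>\<open>lp_close\<close> at \<open>\<delta>\<close> bounds the metric only by
      \<open>\<le> \<delta>\<close>, while the ball of radius \<open>e\<close> is open.\<close>
    define \<delta> where "\<delta> = e/2"
    have \<delta>: "\<delta> > 0" "\<delta> < e"
      using \<open>e > 0\<close> by (auto simp: \<delta>_def)
    obtain Ua where Ua: "openin X Ua" "x \<in> Ua" "\<And>y. y \<in> Ua \<Longrightarrow> \<bar>a x - a y\<bar> < \<delta>"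
    proof -
      have "\<exists>U. openin X U \<and> x \<in> U \<and> (\<forall>y\<in>U. a y \<in> Met_TC.mball (a x) \<delta>)"
        using a(1) x \<delta>(1) by (metis Met_TC.continuous_map_to_metric mtopology_is_euclidean)
      then show ?thesis
        using that by (auto simp: dist_real_def)
    qed
    obtain Uf where Uf: "openin X Uf" "x \<in> Uf" "\<And>y. y \<in> Uf \<Longrightarrow> a x = 0 \<or> a y = 0 \<or> f y \<in> mball (f x) \<delta>"
    proof (cases "a x = 0")
      case True
      with that[of "topspace X"] x show ?thesis by auto
    next
      case False
      have "openin X {x \<in> topspace X. a x > 0}"
        using openin_continuous_map_preimage[OF a(1), of "{0<..}"] by simp
      then obtain U where "openin X U" "x \<in> U" "\<forall>y\<in>U. a y > 0 \<longrightarrow> f y \<in> mball (f x) \<delta>"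
        using near[OF f _ x _ \<delta>(1)] a(2)[OF x] False by force
      moreover have "a y = 0 \<or> a y > 0" if "y \<in> U" for y
        using a(2)[of y] openin_subset[OF \<open>openin X U\<close>] that by force
      ultimately show ?thesis using that by metis
    qed
    obtain Ug where Ug: "openin X Ug" "x \<in> Ug" "\<And>y. y \<in> Ug \<Longrightarrow> a x = 1 \<or> a y = 1 \<or> g y \<in> mball (g x) \<delta>"
    proof (cases "a x = 1")
      case True
      with that[of "topspace X"] x show ?thesis by auto
    next
      case False
      have "openin X {x \<in> topspace X. a x < 1}"
        using openin_continuous_map_preimage[OF a(1), of "{..<1}"] by simp
      then obtain U where "openin X U" "x \<in> U" "\<forall>y\<in>U. a y < 1 \<longrightarrow> g y \<in> mball (g x) \<delta>"
        using near[OF g _ x _ \<delta>(1)] a(2)[OF x] False by force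
      moreover have "a y = 1 \<or> a y < 1" if "y \<in> U" for y
        using a(2)[of y] openin_subset[OF \<open>openin X U\<close>] that by force
      ultimately show ?thesis using that by metis
    qed
    have "mix_pmf (a y) (f y) (g y) \<in> L.mball (mix_pmf (a x) (f x) (g x)) e"
      if y: "y \<in> Ua \<inter> Uf \<inter> Ug" for y
    proof -
      have yX: "y \<in> topspace X"
        using y openin_subset[OF Ua(1)] by auto
      have "lp_close M d \<delta> (mix_pmf (a x) (f x) (g x)) (mix_pmf (a y) (f y) (g y))"
        using a(2)[OF x] a(2)[OF yX] Ua(3)[of y] Uf(3)[of y] Ug(3)[of y] y \<delta>(1)
        by (intro lp_close_mix_pmf) auto
      then show ?thesis
        using levy_prokhorov_le \<delta>(2) mix_in x yX by fastforce
    qed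
    with Ua(1,2) Uf(1,2) Ug(1,2)
    show "\<exists>U. openin X U \<and> x \<in> U \<and>
        (\<forall>y\<in>U. mix_pmf (a y) (f y) (g y) \<in> L.mball (mix_pmf (a x) (f x) (g x)) e)"
      by (intro exI[of _ "Ua \<inter> Uf \<inter> Ug"]) auto
  qed
qed

end

section \<open>The compact-open topology on path spaces\<close>

lemma prod_top_of_set: "prod_topology (top_of_set S) (top_of_set T) = top_of_set (S \<times> T)"
proof -
  have "prod_topology euclidean euclidean = (euclidean :: ('a \<times> 'b) topology)"
    by (simp add: topology_eq openin_prod_topology_alt open_prod_def Ball_def)
  then show ?thesis
    by (metis subtopology_Times)
qed

lemma openin_path_topology_subbasis:
  assumes "compact K" "K \<subseteq> {0..1}" "openin X U"
  shows "openin (path_topology X) {\<phi> \<in> paths X. \<phi> ` K \<subseteq> U}"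
  unfolding path_topology_def using assms by (intro topology_generated_by_Basis) blast

text \<open>Uncurrying, which rests on local compactness of the interval: around \<open>t\<close>
  there is a compact neighbourhood that \<open>f z\<close> maps into \<open>U\<close>, and this is a
  subbasic condition on \<open>f z\<close>.\<close>

lemma continuous_map_eval_path_topology:
  assumes f: "continuous_map Z (path_topology X) f"
  shows "continuous_map (prod_topology (top_of_set {0..1}) Z) X (\<lambda>(t, z). f z t)"
proof -
  have f_paths: "f z \<in> paths X" if "z \<in> topspace Z" for z
    using continuous_map_funspace[OF f] that by auto
  have cont_f: "continuous_map (top_of_set {0..1}) X (f z)" if "z \<in> topspace Z" for z
    using f_paths[OF that] by (simp add: paths_def pathin_def)
  show ?thesis
    unfolding continuous_map_def
  proof (intro conjI allI impI)
    show "(\<lambda>(t, z). f z t) \<in> topspace (prod_topology (top_of_set {0..1}) Z) \<rightarrow> topspace X"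
      using continuous_map_funspace[OF cont_f] by fastforce
  next
    fix U
    assume U: "openin X U"
    let ?W = "{x \<in> topspace (prod_topology (top_of_set {0..1}) Z). (\<lambda>(t, z). f z t) x \<in> U}"
    have "\<exists>V V'. openin (top_of_set {0..1}) V \<and> openin Z V' \<and> t \<in> V \<and> z \<in> V' \<and> V \<times> V' \<subseteq> ?W"
      if "(t, z) \<in> ?W" for t z
    proof -
      from that have t: "t \<in> {0..1}" and z: "z \<in> topspace Z" and "f z t \<in> U"
        by auto
      have "openin (top_of_set {0..1}) {t \<in> {0..1}. f z t \<in> U}"
        using openin_continuous_map_preimage[OF cont_f[OF z] U] by simp
      then obtain r where "r > 0" and r: "cball t r \<inter> {0..1} \<subseteq> {t \<in> {0..1}. f z t \<in> U}"
        using t \<open>f z t \<in> U\<close> unfolding openin_contains_cball by blast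
      \<comment> \<open>The closed ball supplies the compact set of the subbasis, the open ball the
        neighbourhood of \<open>t\<close>.\<close>
      define K where "K = cball t r \<inter> {0..1}"
      define V where "V = {0..1} \<inter> ball t r"
      define V' where "V' = {z \<in> topspace Z. f z \<in> {\<phi> \<in> paths X. \<phi> ` K \<subseteq> U}}"
      have "openin Z V'"
        unfolding V'_def by (intro openin_continuous_map_preimage[OF f] openin_path_topology_subbasis U)
           (auto simp: K_def compact_Int)
      moreover have "openin (top_of_set {0..1}) V"
        unfolding V_def by (intro openin_open_Int) auto
      moreover have "V \<times> V' \<subseteq> ?W"
        by (auto simp: V_def V'_def K_def)
      moreover have "t \<in> V"
        using t \<open>r > 0\<close> by (simp add: V_def)
      moreover have "z \<in> V'"
        using z r f_paths[OF z] by (auto simp: K_def V'_def)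
      ultimately show ?thesis
        by blast
    qed
    then show "openin (prod_topology (top_of_set {0..1}) Z) ?W"
      unfolding openin_prod_topology_alt by blast
  qed
qed

text \<open>Currying, by the tube lemma: the pairs in \<open>K \<times> Z\<close> sent outside
  \<open>U\<close> form a closed set, and projection along the compact \<open>K\<close> is a closed
  map. The complement of the projection is the preimage of a subbasic set.\<close>

lemma continuous_map_into_path_topology:
  assumes cont: "continuous_map (prod_topology (top_of_set {0..1}) Z) X (\<lambda>(t, z). f z t)"
    and ext: "\<And>z. z \<in> topspace Z \<Longrightarrow> f z \<in> extensional {0..1}"
  shows "continuous_map Z (path_topology X) f"
proof -
  have paths: "f z \<in> paths X" if "z \<in> topspace Z" for z
  proof -
    have "continuous_map (top_of_set {0..1}) (prod_topology (top_of_set {0..1}) Z) (\<lambda>t. (t, z))"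
      using that by (auto intro!: continuous_map_pairedI)
    from continuous_map_compose[OF this cont] show ?thesis
      using ext[OF that] by (simp add: paths_def pathin_def o_def)
  qed
  show ?thesis
    unfolding path_topology_def
  proof (rule continuous_on_generated_topo)
    fix W
    assume "W \<in> {{\<phi> \<in> paths X. \<phi> ` K \<subseteq> U} |K U. compact K \<and> K \<subseteq> {0..1} \<and> openin X U}"
    then obtain K U where W: "W = {\<phi> \<in> paths X. \<phi> ` K \<subseteq> U}"
      and K: "compact K" "K \<subseteq> {0..1}" and U: "openin X U"
      by blast
    let ?P = "prod_topology (top_of_set K) Z"
    have P: "?P = subtopology (prod_topology (top_of_set {0..1}) Z) (K \<times> UNIV)"
      using K(2) by (simp add: subtopology_Times subtopology_subtopology Int_absorb1)
    have "continuous_map ?P X (\<lambda>(t, z). f z t)"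
      unfolding P by (rule continuous_map_from_subtopology[OF cont])
    moreover have "closedin X (topspace X - U)"
      using U by blast
    ultimately have closed: "closedin ?P {x \<in> topspace ?P. (\<lambda>(t, z). f z t) x \<in> topspace X - U}"
      by (rule closedin_continuous_map_preimage)
    have "compact_space (top_of_set K)"
      using K(1) by (simp add: compact_space_subtopology)
    then have "closed_map ?P Z snd"
      by (rule closed_map_snd)
    with closed have "closedin Z (snd ` {x \<in> topspace ?P. (\<lambda>(t, z). f z t) x \<in> topspace X - U})"
      by (simp add: closed_map_def)
    moreover have "f -` W \<inter> topspace Z
        = topspace Z - snd ` {x \<in> topspace ?P. (\<lambda>(t, z). f z t) x \<in> topspace X - U}"
    proof -
      have "f z t \<in> topspace X" if "z \<in> topspace Z" "t \<in> K" for z t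
        using funcset_mem[OF continuous_map_funspace[OF cont], of "(t, z)"] that K(2) by auto
      with paths show ?thesis
        by (force simp: W image_iff)
    qed
    ultimately show "openin Z (f -` W \<inter> topspace Z)"
      by auto
  next
    show "f ` topspace Z \<subseteq> \<Union> {{\<phi> \<in> paths X. \<phi> ` K \<subseteq> U} |K U. compact K \<and> K \<subseteq> {0..1} \<and> openin X U}"
    proof -
      \<comment> \<open>For \<open>K = {}\<close> the condition is void, so the set of all paths is
        itself subbasic.\<close>
      have "\<exists>K U. paths X = {\<phi> \<in> paths X. \<phi> ` K \<subseteq> U} \<and> compact K \<and> K \<subseteq> {0..1} \<and> openin X U"
        by (intro exI[of _ "{}"]) simp
      with paths show ?thesis
        by blast
    qed
  qed
qed

section \<open>Unit representatives of points of projective space\<close>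

lemma proj_class_scaleR:
  assumes "c \<noteq> 0"
  shows "proj_class (c *\<^sub>R v) = proj_class v"
proof (intro equalityI subsetI)
  fix x assume "x \<in> proj_class v"
  then obtain b where "b \<noteq> 0" "x = b *\<^sub>R v"
    by (auto simp: proj_class_def)
  with assms show "x \<in> proj_class (c *\<^sub>R v)"
    by (auto simp: proj_class_def intro!: exI[of _ "b / c"])
qed (use assms in \<open>auto simp: proj_class_def\<close>)

lemma proj_class_minus [simp]: "proj_class (- v) = proj_class v"
  using proj_class_scaleR[of "-1" v] by simp

lemma self_in_proj_class: "v \<in> proj_class v"
  by (auto simp: proj_class_def intro!: exI[of _ 1])

lemma topspace_projective_space:
  "topspace (projective_space :: (real ^ 'm) set topology) = proj_class ` (- {0})"
  using quotient_map_proj_class[where 'a = 'm] by (simp add: quotient_map_def)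

lemma proj_class_image_sphere: "proj_class ` sphere 0 1 = topspace projective_space"
proof -
  have "proj_class v \<in> proj_class ` sphere 0 1" if "v \<noteq> 0" for v :: "real ^ 'm"
  proof (rule image_eqI)
    show "proj_class v = proj_class ((1 / norm v) *\<^sub>R v)"
      using that by (simp add: proj_class_scaleR)
  qed (use that in simp)
  then show ?thesis
    by (auto simp: topspace_projective_space)
qed

lemma continuous_map_proj_class_compose:
  assumes "continuous_on S f" "\<And>x. x \<in> S \<Longrightarrow> f x \<noteq> 0"
  shows "continuous_map (top_of_set S) projective_space (\<lambda>x. proj_class (f x))"
proof -
  have "continuous_map (top_of_set S) (top_of_set (- {0})) f"
    using assms by auto
  from continuous_map_compose[OF this quotient_imp_continuous_map[OF quotient_map_proj_class]]
  show ?thesis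
    by (simp add: o_def)
qed

lemma quotient_map_proj_class_sphere:
  "quotient_map (top_of_set (sphere 0 1)) projective_space proj_class"
  by (rule continuous_imp_quotient_map)
     (auto simp: proj_class_image_sphere compact_space_subtopology
       intro!: continuous_map_proj_class_compose metrizable_imp_Hausdorff_space metrizable_projective_space)

text \<open>A product of quotient maps need not be a quotient map; here it is one because the source
  is compact and the target Hausdorff. This is the reason for passing from nonzero vectors to unit
  vectors.\<close>

lemma quotient_map_proj_class_sphere_prod:
  "quotient_map (top_of_set (sphere 0 1 \<times> sphere 0 1)) (prod_topology projective_space projective_space)
     (\<lambda>(v, w). (proj_class v, proj_class w))"
proof (rule continuous_imp_quotient_map)
  show "continuous_map (top_of_set (sphere 0 1 \<times> sphere 0 1)) (prod_topology projective_space projective_space)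
     (\<lambda>(v, w). (proj_class v, proj_class w))"
    unfolding case_prod_unfold
    by (intro continuous_map_pairedI continuous_map_proj_class_compose continuous_intros) auto
  show "compact_space (top_of_set (sphere 0 1 \<times> sphere 0 1 :: ((real ^ 'n) \<times> (real ^ 'm)) set))"
    by (simp add: compact_space_subtopology compact_Times)
  show "Hausdorff_space (prod_topology (projective_space :: (real ^ 'n) set topology)
      (projective_space :: (real ^ 'm) set topology))"
    by (simp add: Hausdorff_space_prod_topology metrizable_imp_Hausdorff_space metrizable_projective_space)
  show "(\<lambda>(v, w). (proj_class v, proj_class w)) ` topspace (top_of_set (sphere 0 1 \<times> sphere 0 1))
      = topspace (prod_topology projective_space projective_space)"
    by (simp add: image_paired_Times proj_class_image_sphere)
qed

text \<open>The sign is left to the choice operator; only expressions insensitive to it are formed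
  below.\<close>

definition unit_rep :: "(real ^ 'm) set \<Rightarrow> real ^ 'm" where
  "unit_rep L = (SOME v. v \<in> L \<and> norm v = 1)"

lemma unit_rep_proj_class:
  assumes "norm v = 1"
  shows "unit_rep (proj_class v) = v \<or> unit_rep (proj_class v) = - v"
proof -
  define u where "u = unit_rep (proj_class v)"
  have u: "u \<in> proj_class v \<and> norm u = 1"
    unfolding u_def unit_rep_def by (rule someI[of _ v]) (simp add: assms self_in_proj_class)
  then obtain c where c: "u = c *\<^sub>R v"
    unfolding proj_class_def by blast
  with u have "\<bar>c\<bar> = 1"
    using assms by simp
  with c show ?thesis
    unfolding u_def[symmetric] by (auto simp: abs_if split: if_splits)
qed

section \<open>The section by measures with two atoms\<close>

definition segment_path :: "real ^ 'm \<Rightarrow> real ^ 'm \<Rightarrow> real \<Rightarrow> (real ^ 'm) set" where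
  "segment_path v w = (\<lambda>t\<in>{0..1}. proj_class ((1 - t) *\<^sub>R v + t *\<^sub>R w))"

lemma segment_path_minus_left: "segment_path (- v) w = segment_path v (- w)"
proof -
  have "proj_class ((1 - t) *\<^sub>R (- v) + t *\<^sub>R w) = proj_class ((1 - t) *\<^sub>R v + t *\<^sub>R (- w))" for t
    using proj_class_minus[of "(1 - t) *\<^sub>R v + t *\<^sub>R (- w)"] by simp
  then show ?thesis
    by (simp add: segment_path_def)
qed

lemma path_endpoints_segment_path: "path_endpoints (segment_path v w) = (proj_class v, proj_class w)"
  by (simp add: path_endpoints_def segment_path_def)

lemma convex_combination_unit_nonzero:
  fixes v w :: "'a::real_normed_vector"
  assumes "norm v = 1" "norm w = 1" "v \<noteq> - w" "t \<in> {0..1}"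
  shows "(1 - t) *\<^sub>R v + t *\<^sub>R w \<noteq> 0"
proof
  assume "(1 - t) *\<^sub>R v + t *\<^sub>R w = 0"
  then have eq: "(1 - t) *\<^sub>R v = - (t *\<^sub>R w)"
    by (simp add: eq_neg_iff_add_eq_0)
  \<comment> \<open>For unit vectors these norms are \<open>1 - t\<close> and
    \<open>t\<close>.\<close>
  then have "norm ((1 - t) *\<^sub>R v) = norm (t *\<^sub>R w)"
    by simp
  then have "t = 1/2"
    using assms by simp
  with eq \<open>v \<noteq> - w\<close> show False
    by (simp flip: scaleR_minus_right)
qed

lemma continuous_map_segment_path:
  assumes "continuous_on Z f" "continuous_on Z g"
    and "\<And>z. z \<in> Z \<Longrightarrow> norm (f z) = 1 \<and> norm (g z) = 1 \<and> f z \<noteq> - g z"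
  shows "continuous_map (top_of_set Z) (path_topology projective_space) (\<lambda>z. segment_path (f z) (g z))"
proof (rule continuous_map_into_path_topology)
  have "continuous_map (top_of_set ({0..1} \<times> Z)) projective_space
      (\<lambda>x. proj_class ((1 - fst x) *\<^sub>R f (snd x) + fst x *\<^sub>R g (snd x)))"
  proof (rule continuous_map_proj_class_compose)
    show "continuous_on ({0..1} \<times> Z) (\<lambda>x. (1 - fst x) *\<^sub>R f (snd x) + fst x *\<^sub>R g (snd x))"
      by (intro continuous_intros continuous_on_compose2[OF assms(1)] continuous_on_compose2[OF assms(2)]) auto
    show "(1 - fst x) *\<^sub>R f (snd x) + fst x *\<^sub>R g (snd x) \<noteq> 0" if "x \<in> {0..1} \<times> Z" for x
      using that assms(3)[of "snd x"] by (intro convex_combination_unit_nonzero) auto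
  qed
  then have "continuous_map (top_of_set ({0..1} \<times> Z)) projective_space
      (\<lambda>(t, z). segment_path (f z) (g z) t)"
    by (rule continuous_map_eq) (auto simp: segment_path_def)
  then show "continuous_map (prod_topology (top_of_set {0..1}) (top_of_set Z)) projective_space
      (\<lambda>(t, z). segment_path (f z) (g z) t)"
    by (simp add: prod_top_of_set)
qed (simp add: segment_path_def)

text \<open>If \<open>v\<close> and \<open>w\<close> enclose the angle \<open>\<theta>\<close>, the
  weights are the squares of cos(\<open>\<theta>\<close>/2) and
  sin(\<open>\<theta>\<close>/2).\<close>

definition two_paths :: "real ^ 'm \<Rightarrow> real ^ 'm \<Rightarrow> (real \<Rightarrow> (real ^ 'm) set) pmf" where
  "two_paths v w = mix_pmf ((1 + v \<bullet> w) / 2) (segment_path v w) (segment_path v (- w))"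

lemma inner_unit_bounds:
  assumes "norm v = 1" "norm w = 1"
  shows "- 1 \<le> v \<bullet> w" "v \<bullet> w \<le> 1"
  using Cauchy_Schwarz_ineq2[of v w] assms by auto

lemma two_paths_minus_right:
  assumes "norm v = 1" "norm w = 1"
  shows "two_paths v (- w) = two_paths v w"
  using mix_pmf_swap[of "(1 + v \<bullet> w) / 2" "segment_path v (- w)" "segment_path v w"]
    inner_unit_bounds[OF assms]
  by (simp add: two_paths_def field_simps)

lemma two_paths_minus_left:
  assumes "norm v = 1" "norm w = 1"
  shows "two_paths (- v) w = two_paths v w"
  using two_paths_minus_right[OF assms]
  by (simp add: two_paths_def segment_path_minus_left)

lemma set_two_paths_subset: "set_pmf (two_paths v w) \<subseteq> {segment_path v w, segment_path v (- w)}"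
  by (auto simp: two_paths_def mix_pmf_def)

lemma path_endpoints_two_paths:
  "\<phi> \<in> set_pmf (two_paths v w) \<Longrightarrow> path_endpoints \<phi> = (proj_class v, proj_class w)"
  using set_two_paths_subset[of v w] by (auto simp: path_endpoints_segment_path)

lemma continuous_map_two_paths:
  assumes "Metric_space (paths projective_space) \<rho>"
    and top: "Metric_space.mtopology (paths projective_space) \<rho> = path_topology projective_space"
  shows "continuous_map (top_of_set (sphere 0 1 \<times> sphere 0 1))
    (finsupp_topology (paths projective_space) \<rho> 2) (\<lambda>(v, w). two_paths v w)"
proof -
  interpret Metric_space "paths projective_space" \<rho>
    by fact
  show ?thesis
    unfolding two_paths_def case_prod_unfold
  proof (rule continuous_map_mix_pmf, unfold top subtopology_subtopology)
    show "continuous_map (top_of_set (sphere 0 1 \<times> sphere 0 1)) euclideanreal (\<lambda>x. (1 + fst x \<bullet> snd x) / 2)"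
      by (auto intro!: continuous_intros)
  next
    fix x :: "(real ^ 'a) \<times> (real ^ 'a)"
    assume "x \<in> topspace (top_of_set (sphere 0 1 \<times> sphere 0 1))"
    then show "0 \<le> (1 + fst x \<bullet> snd x) / 2 \<and> (1 + fst x \<bullet> snd x) / 2 \<le> 1"
      using inner_unit_bounds[of "fst x" "snd x"] by auto
  next
    show "continuous_map (top_of_set (sphere 0 1 \<times> sphere 0 1 \<inter> {x. 0 < (1 + fst x \<bullet> snd x) / 2}))
        (path_topology projective_space) (\<lambda>x. segment_path (fst x) (snd x))"
      \<comment> \<open>Positive weight means \<open>v \<bullet> w > - 1\<close>, which excludes
        \<open>v = - w\<close>.\<close>
      by (rule continuous_map_segment_path)
         (auto intro!: continuous_intros simp: norm_eq_1)
  next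
    show "continuous_map (top_of_set (sphere 0 1 \<times> sphere 0 1 \<inter> {x. (1 + fst x \<bullet> snd x) / 2 < 1}))
        (path_topology projective_space) (\<lambda>x. segment_path (fst x) (- snd x))"
      by (rule continuous_map_segment_path)
         (auto intro!: continuous_intros simp: norm_eq_1)
  qed
qed

definition two_paths_section ::
    "(real ^ 'm) set \<times> (real ^ 'm) set \<Rightarrow> (real \<Rightarrow> (real ^ 'm) set) pmf" where
  "two_paths_section = (\<lambda>(L, L'). two_paths (unit_rep L) (unit_rep L'))"

text \<open>Sign invariance in both arguments absorbs the choices made by
  \<open>unit_rep\<close>.\<close>

lemma two_paths_section_proj_class:
  assumes "norm v = 1" "norm w = 1"
  shows "two_paths_section (proj_class v, proj_class w) = two_paths v w"
  using unit_rep_proj_class[OF assms(1)] unit_rep_proj_class[OF assms(2)] assms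
  by (auto simp: two_paths_section_def two_paths_minus_left two_paths_minus_right)

lemma continuous_map_two_paths_section:
  assumes "Metric_space (paths projective_space) \<rho>"
    and "Metric_space.mtopology (paths projective_space) \<rho> = path_topology projective_space"
  shows "continuous_map (prod_topology projective_space projective_space)
    (finsupp_topology (paths projective_space) \<rho> 2) two_paths_section"
proof (rule continuous_compose_quotient_map[OF quotient_map_proj_class_sphere_prod])
  show "continuous_map (top_of_set (sphere 0 1 \<times> sphere 0 1)) (finsupp_topology (paths projective_space) \<rho> 2)
      (two_paths_section \<circ> (\<lambda>(v, w). (proj_class v, proj_class w)))"
    by (rule continuous_map_eq[OF continuous_map_two_paths[OF assms]])
       (auto simp: two_paths_section_proj_class)
qed

section \<open>Equivariance and the upper bound\<close>

lemma fibre_projection_eq: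
  assumes "x \<in> topspace B" "set_pmf \<mu> \<subseteq> {e \<in> E. p e = x}"
  shows "fibre_projection E B p \<mu> = x"
  unfolding fibre_projection_def
proof (rule the_equality)
  fix y
  assume "y \<in> topspace B \<and> set_pmf \<mu> \<subseteq> {e \<in> E. p e = y}"
  \<comment> \<open>A support is nonempty, so it cannot lie in two different fibres.\<close>
  with assms(2) set_pmf_not_empty[of \<mu>] show "y = x"
    by blast
qed (use assms in blast)

lemma inner_block_embedding:
  assumes "orthogonal_matrix A"
  shows "(block_embedding A *v v) \<bullet> (block_embedding A *v w) = v \<bullet> w"
proof -
  have sum_option: "sum f UNIV = f None + (\<Sum>i\<in>UNIV. f (Some i))" for f :: "'a option \<Rightarrow> real"
    by (simp add: UNIV_option_conv sum.reindex)
  \<comment> \<open>The block matrix fixes the last coordinate and acts by \<open>A\<close> on the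
    others.\<close>
  have None: "(block_embedding A *v v) $ None = v $ None"
    and Some: "(block_embedding A *v v) $ Some i = (A *v (\<chi> j. v $ Some j)) $ i" for v i
    by (simp_all add: block_embedding_def matrix_vector_mult_def sum_option)
  have "orthogonal_transformation ((*v) A)"
    using assms by (simp add: orthogonal_transformation_matrix)
  then have "(A *v (\<chi> j. v $ Some j)) \<bullet> (A *v (\<chi> j. w $ Some j)) = (\<chi> j. v $ Some j) \<bullet> (\<chi> j. w $ Some j)"
    by (simp add: orthogonal_transformation_def)
  then show ?thesis
    by (simp add: inner_vec_def sum_option None Some)
qed

lemma path_action_segment_path:
  "path_action projective_action A (segment_path v w) =
     segment_path (block_embedding A *v v) (block_embedding A *v w)"
  unfolding path_action_def segment_path_def
  by (rule ext) (simp add: projective_action_proj_class matrix_vector_right_distrib matrix_vector_mult_scaleR)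

lemma map_pmf_two_paths:
  assumes "orthogonal_matrix A"
  shows "map_pmf (path_action projective_action A) (two_paths v w) =
    two_paths (block_embedding A *v v) (block_embedding A *v w)"
proof -
  have "block_embedding A *v (- w) = - (block_embedding A *v w)"
    using matrix_vector_mult_scaleR[of "block_embedding A" "-1" w] by simp
  then show ?thesis
    by (simp add: two_paths_def map_mix_pmf path_action_segment_path inner_block_embedding[OF assms])
qed

lemma equivariant_section_two_paths_section:
  fixes \<rho> :: "(real \<Rightarrow> (real ^ 'n::finite option) set) \<Rightarrow> (real \<Rightarrow> (real ^ 'n option) set) \<Rightarrow> real"
  assumes "Metric_space (paths projective_space) \<rho>"
    and "Metric_space.mtopology (paths projective_space) \<rho> = path_topology projective_space"
  shows "equivariant_section special_orthogonal (path_action projective_action) (paths projective_space) \<rho>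
    (diagonal_action projective_action) (prod_topology projective_space projective_space)
    path_endpoints 2 two_paths_section"
proof -
  interpret Metric_space "paths (projective_space :: (real ^ 'n option) set topology)" \<rho>
    by fact
  let ?B = "prod_topology projective_space projective_space :: ((real ^ 'n option) set \<times> (real ^ 'n option) set) topology"
  note cont = continuous_map_two_paths_section[OF assms]
  have B: thesis if "x \<in> topspace ?B"
    and "\<And>v w. norm v = 1 \<Longrightarrow> norm w = 1 \<Longrightarrow> x = (proj_class v, proj_class w) \<Longrightarrow> thesis" for x thesis
    using that by (auto simp flip: proj_class_image_sphere)
  have in_fin: "two_paths_section x \<in> finsupp_measures (paths projective_space) 2" if "x \<in> topspace ?B" for x
    using continuous_map_funspace[OF cont] that by auto
  have supp: "set_pmf (two_paths_section x) \<subseteq> {\<phi> \<in> paths projective_space. path_endpoints \<phi> = x}"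
    if x: "x \<in> topspace ?B" for x
  proof -
    obtain v w where vw: "norm v = 1" "norm w = 1" "x = (proj_class v, proj_class w)"
      using B[OF x] by blast
    then have "path_endpoints \<phi> = x" if "\<phi> \<in> set_pmf (two_paths_section x)" for \<phi>
      using path_endpoints_two_paths that by (simp add: two_paths_section_proj_class)
    then show ?thesis
      using in_fin[OF x] by (auto simp: finsupp_measures_def)
  qed
  have fibre: "two_paths_section x \<in> fibre_measures (paths projective_space) ?B path_endpoints 2"
    if "x \<in> topspace ?B" for x
    using in_fin[OF that] supp[OF that] that unfolding fibre_measures_def by blast
  show ?thesis
    unfolding equivariant_section_def
  proof (intro conjI ballI)
    show "continuous_map ?B (subtopology (finsupp_topology (paths projective_space) \<rho> 2)
        (fibre_measures (paths projective_space) ?B path_endpoints 2)) two_paths_section"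
      using cont fibre by (simp only: continuous_map_in_subtopology) blast
  next
    fix x
    assume "x \<in> topspace ?B"
    then show "fibre_projection (paths projective_space) ?B path_endpoints (two_paths_section x) = x"
      by (intro fibre_projection_eq supp)
  next
    fix A :: "real ^ 'n ^ 'n" and x
    assume A: "A \<in> special_orthogonal" and x: "x \<in> topspace ?B"
    have orth: "orthogonal_matrix A"
      using A by (simp add: special_orthogonal_def rotation_matrix_def)
    obtain v w where vw: "norm v = 1" "norm w = 1" "x = (proj_class v, proj_class w)"
      using B[OF x] by blast
    \<comment> \<open>The images are again unit vectors, so the formula for unit representatives
      applies to the moved lines.\<close>
    then have "norm (block_embedding A *v v) = 1" "norm (block_embedding A *v w) = 1"
      by (simp_all add: norm_eq_1 inner_block_embedding[OF orth])
    then show "two_paths_section (diagonal_action projective_action A x) =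
        map_pmf (path_action projective_action A) (two_paths_section x)"
      using vw by (simp add: diagonal_action_def projective_action_proj_class
          two_paths_section_proj_class map_pmf_two_paths[OF orth])
  qed
qed

section \<open>The sphere as a double cover\<close>

text \<open>Covering spaces in the library live on type classes, so projective space is replaced here by
  its model consisting of the symmetric matrices \<open>v v\<^sup>T\<close>.\<close>

definition outer :: "real ^ 'm \<Rightarrow> real ^ 'm ^ 'm" where
  "outer v = (\<chi> i j. v $ i * v $ j)"

lemma outer_minus [simp]: "outer (- v) = outer v"
  by (simp add: outer_def)

text \<open>For a unit vector, \<open>outer u\<close> is the orthogonal projection onto the line of
  \<open>u\<close>. Applying it to a vector not orthogonal to \<open>u\<close> recovers
  \<open>u\<close> up to scale.\<close>

lemma outer_mult_vector: "outer u *v v = (u \<bullet> v) *\<^sub>R u"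
  by (simp add: outer_def matrix_vector_mult_def inner_vec_def vec_eq_iff sum_distrib_left sum_distrib_right mult_ac)

lemma outer_eq_iff:
  assumes "norm u = 1" "norm v = 1"
  shows "outer u = outer v \<longleftrightarrow> u = v \<or> u = - v"
proof
  assume "outer u = outer v"
  then have "outer u *v v = outer v *v v"
    by simp
  then have eq: "(u \<bullet> v) *\<^sub>R u = v"
    using assms by (simp add: outer_mult_vector norm_eq_1)
  then have "\<bar>u \<bullet> v\<bar> = 1"
    using assms by (metis mult.right_neutral norm_scaleR)
  with eq show "u = v \<or> u = - v"
    by (auto simp: abs_if split: if_splits)
qed auto

lemma continuous_on_outer: "continuous_on S outer"
  unfolding outer_def by (intro continuous_intros)

text \<open>A line not orthogonal to \<open>v\<close> has exactly one unit vector in each open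
  half-space cut out by \<open>v\<close>. It is found by projecting \<open>v\<close> to the line and
  normalising; \<open>s\<close> selects the half-space.\<close>

lemma homeomorphism_half_sphere:
  fixes v :: "real ^ 'm"
  assumes s: "s = 1 \<or> s = - 1"
  shows "homeomorphism {u \<in> sphere 0 1. s * (u \<bullet> v) > 0} {M \<in> outer ` sphere 0 1. M *v v \<noteq> 0}
    outer (\<lambda>M. (s / norm (M *v v)) *\<^sub>R (M *v v))"
proof (rule homeomorphismI)
  have cont: "continuous_on T (\<lambda>M :: real ^ 'm ^ 'm. M *v v)" for T
    unfolding matrix_vector_mult_def by (intro continuous_intros)
  then show "continuous_on {M \<in> outer ` sphere 0 1. M *v v \<noteq> 0} (\<lambda>M. (s / norm (M *v v)) *\<^sub>R (M *v v))"
    by (intro continuous_intros) auto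
  have retract: "(s / norm (outer u *v v)) *\<^sub>R (outer u *v v) = (s * sgn (u \<bullet> v)) *\<^sub>R u" if "norm u = 1" for u
    using that by (simp add: outer_mult_vector sgn_if)
  show "(s / norm (outer u *v v)) *\<^sub>R (outer u *v v) = u"
    if "u \<in> {u \<in> sphere 0 1. s * (u \<bullet> v) > 0}" for u
    using that s retract[of u] by (auto simp: sgn_if)
  show "outer ` {u \<in> sphere 0 1. s * (u \<bullet> v) > 0} \<subseteq> {M \<in> outer ` sphere 0 1. M *v v \<noteq> 0}"
    by (auto simp: outer_mult_vector)
  have *: "(s * sgn (u \<bullet> v)) *\<^sub>R u \<in> {u \<in> sphere 0 1. s * (u \<bullet> v) > 0}" "outer ((s * sgn (u \<bullet> v)) *\<^sub>R u) = outer u"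
    if "norm u = 1" "u \<bullet> v \<noteq> 0" for u
    using that s by (auto simp: sgn_if)
  show "(\<lambda>M. (s / norm (M *v v)) *\<^sub>R (M *v v)) ` {M \<in> outer ` sphere 0 1. M *v v \<noteq> 0}
      \<subseteq> {u \<in> sphere 0 1. s * (u \<bullet> v) > 0}"
  proof (intro image_subsetI)
    fix M
    assume "M \<in> {M \<in> outer ` sphere 0 1. M *v v \<noteq> 0}"
    then obtain u where u: "norm u = 1" "M = outer u" "u \<bullet> v \<noteq> 0"
      by (auto simp: outer_mult_vector)
    show "(s / norm (M *v v)) *\<^sub>R (M *v v) \<in> {u \<in> sphere 0 1. s * (u \<bullet> v) > 0}"
      unfolding u(2) retract[OF u(1)] using *(1)[OF u(1,3)] .
  qed
  show "outer ((s / norm (M *v v)) *\<^sub>R (M *v v)) = M" if "M \<in> {M \<in> outer ` sphere 0 1. M *v v \<noteq> 0}" for M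
  proof -
    from that obtain u where u: "norm u = 1" "M = outer u" "u \<bullet> v \<noteq> 0"
      by (auto simp: outer_mult_vector)
    show ?thesis
      unfolding u(2) retract[OF u(1)] using *(2)[OF u(1,3)] .
  qed
qed (rule continuous_on_outer)

text \<open>The lines not orthogonal to \<open>v\<close> form an evenly covered neighbourhood of
  \<open>outer v\<close>, with two opposite open hemispheres as sheets.\<close>

lemma covering_space_outer:
  "covering_space (sphere 0 1 :: (real ^ 'm) set) outer (outer ` sphere 0 1)"
proof
  fix M :: "real ^ 'm ^ 'm"
  assume "M \<in> outer ` sphere 0 1"
  then obtain v :: "real ^ 'm" where v: "norm v = 1" "M = outer v"
    by auto
  let ?S = "sphere 0 1 :: (real ^ 'm) set"
  define T where "T = {M \<in> outer ` ?S. M *v v \<noteq> 0}"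
  define H where "H s = {u \<in> ?S. s * (u \<bullet> v) > 0}" for s
  have "v \<noteq> 0"
    using v(1) by auto
  then have "M \<in> T"
    using v by (auto simp: T_def outer_mult_vector)
  moreover have "openin (top_of_set (outer ` ?S)) T"
  proof -
    have "continuous_on (outer ` ?S) (\<lambda>M. M *v v)"
      unfolding matrix_vector_mult_def by (intro continuous_intros)
    then have "openin (top_of_set (outer ` ?S)) (outer ` ?S \<inter> (\<lambda>M. M *v v) -` (- {0}))"
      by (rule continuous_openin_preimage_gen) auto
    moreover have "outer ` ?S \<inter> (\<lambda>M. M *v v) -` (- {0}) = T"
      by (auto simp: T_def)
    ultimately show ?thesis
      by simp
  qed
  moreover have "\<exists>V. \<Union> V = ?S \<inter> outer -` T \<and> (\<forall>u\<in>V. openin (top_of_set ?S) u) \<and>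
    pairwise disjnt V \<and> (\<forall>u\<in>V. \<exists>q. homeomorphism u T outer q)"
  proof (intro exI[of _ "{H 1, H (- 1)}"] conjI)
    show "\<Union> {H 1, H (- 1)} = ?S \<inter> outer -` T"
      by (auto simp: H_def T_def outer_mult_vector)
    have "openin (top_of_set ?S) (H s)" for s
    proof -
      have "continuous_on ?S (\<lambda>u. s * (u \<bullet> v))"
        by (intro continuous_intros)
      then have "openin (top_of_set ?S) (?S \<inter> (\<lambda>u. s * (u \<bullet> v)) -` {0<..})"
        by (rule continuous_openin_preimage_gen) (rule open_greaterThan)
      moreover have "?S \<inter> (\<lambda>u. s * (u \<bullet> v)) -` {0<..} = H s"
        by (auto simp: H_def)
      ultimately show ?thesis
        by simp
    qed
    then show "\<forall>u\<in>{H 1, H (- 1)}. openin (top_of_set ?S) u"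
      by blast
    show "pairwise disjnt {H 1, H (- 1)}"
      by (auto simp: pairwise_def disjnt_def H_def)
    have "\<exists>q. homeomorphism (H s) T outer q" if "s = 1 \<or> s = - 1" for s
      using homeomorphism_half_sphere[OF that, of v] unfolding H_def T_def by blast
    then show "\<forall>u\<in>{H 1, H (- 1)}. \<exists>q. homeomorphism u T outer q"
      by blast
  qed
  ultimately show "\<exists>T. M \<in> T \<and> openin (top_of_set (outer ` ?S)) T \<and>
      (\<exists>V. \<Union> V = ?S \<inter> outer -` T \<and> (\<forall>u\<in>V. openin (top_of_set ?S) u) \<and>
        pairwise disjnt V \<and> (\<forall>u\<in>V. \<exists>q. homeomorphism u T outer q))"
    by blast
qed (simp_all add: continuous_on_outer)

text \<open>\<open>unit_rep\<close> need not be continuous, but \<open>outer\<close> does not see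
  its sign. The composite carries maps into projective space over to the matrix model.\<close>

lemma continuous_map_outer_unit_rep:
  "continuous_map (projective_space :: (real ^ 'm) set topology) euclidean (\<lambda>L. outer (unit_rep L))"
proof (rule continuous_compose_quotient_map[OF quotient_map_proj_class_sphere])
  have "outer (unit_rep (proj_class v)) = outer v" if "norm v = 1" for v :: "real ^ 'm"
    using unit_rep_proj_class[OF that] by auto
  then have "continuous_on (sphere 0 1 :: (real ^ 'm) set) (\<lambda>v. outer (unit_rep (proj_class v)))"
    by (intro continuous_on_eq[OF continuous_on_outer]) simp
  then show "continuous_map (top_of_set (sphere 0 1 :: (real ^ 'm) set)) euclidean ((\<lambda>L. outer (unit_rep L)) \<circ> proj_class)"
    unfolding o_def continuous_map_iff_continuous .
qed

section \<open>Non-contractibility of projective space and the lower bound\<close>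

text \<open>Lifting the path from \<open>[v]\<close> to \<open>[w]\<close> to one starting at \<open>v\<close> gives an end point \<open>\<plusminus>w\<close> that
  is an odd continuous function of \<open>v\<close>, but the sphere is connected.\<close>

lemma no_contraction_projective_space:
  fixes f :: "(real ^ 'm) set \<Rightarrow> real \<Rightarrow> (real ^ 'm) set"
  assumes dim: "CARD('m::finite) \<ge> 2"
    and f: "continuous_map projective_space (path_topology projective_space) f"
    and start: "\<And>L. L \<in> topspace projective_space \<Longrightarrow> f L 0 = L"
    and finish: "\<And>L. L \<in> topspace projective_space \<Longrightarrow> f L 1 = L'"
  shows False
proof -
  let ?S = "sphere 0 1 :: (real ^ 'm) set"
  define h where "h = (\<lambda>(t, v). outer (unit_rep (f (proj_class v) t)))"
  have proj_in: "proj_class v \<in> topspace projective_space" if "v \<in> ?S" for v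
    using that by (simp flip: proj_class_image_sphere)
  have f': "continuous_map (top_of_set ?S) (path_topology projective_space) (\<lambda>v. f (proj_class v))"
    using continuous_map_compose[OF quotient_imp_continuous_map[OF quotient_map_proj_class_sphere] f]
    by (simp add: o_def)
  note ev = continuous_map_eval_path_topology[OF f', unfolded prod_top_of_set]
  have "continuous_map (top_of_set ({0..1} \<times> ?S)) euclidean h"
    using continuous_map_compose[OF ev continuous_map_outer_unit_rep]
    by (simp add: h_def o_def case_prod_unfold)
  then have h: "continuous_on ({0..1} \<times> ?S) h"
    by simp
  have outer_rep: "outer (unit_rep (proj_class v)) = outer v" if "norm v = 1" for v :: "real ^ 'm"
    using unit_rep_proj_class[OF that] by auto
  have him: "h \<in> {0..1} \<times> ?S \<rightarrow> outer ` ?S"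
  proof
    fix x :: "real \<times> (real ^ 'm)"
    assume "x \<in> {0..1} \<times> ?S"
    then have "x \<in> topspace (top_of_set ({0..1} \<times> ?S))"
      unfolding topspace_euclidean_subtopology .
    from funcset_mem[OF continuous_map_funspace[OF ev] this] have "f (proj_class (snd x)) (fst x) \<in> topspace projective_space"
      by (simp add: case_prod_unfold)
    then obtain u :: "real ^ 'm" where "norm u = 1" "f (proj_class (snd x)) (fst x) = proj_class u"
      by (auto simp flip: proj_class_image_sphere)
    then show "h x \<in> outer ` ?S"
      by (simp add: h_def case_prod_unfold outer_rep)
  qed
  have h0: "h (0, v) = outer v" if "v \<in> ?S" for v
    using that by (simp add: h_def start[OF proj_in] outer_rep)
  obtain k where k: "continuous_on ({0..1} \<times> ?S) k" "k \<in> {0..1} \<times> ?S \<rightarrow> ?S"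
    "\<And>v. v \<in> ?S \<Longrightarrow> k (0, v) = v" "\<And>x. x \<in> {0..1} \<times> ?S \<Longrightarrow> h x = outer (k x)"
    using covering_space_lift_homotopy[OF covering_space_outer h him h0 continuous_on_id] by auto
  have odd: "k (1, - v) = - k (1, v)" if v: "v \<in> ?S" for v
  proof -
    have pair: "continuous_on {0..1} (\<lambda>t. k (t, u))" if "u \<in> ?S" for u
      using that by (intro continuous_on_compose2[OF k(1)] continuous_intros) auto
    have v': "- v \<in> ?S"
      using v by simp
    have "- k (1, - v) = k (1, v)"
    \<comment> \<open>Both curves lift \<open>h (t, v)\<close> from the start \<open>v\<close>:
      \<open>v\<close> and \<open>- v\<close> span the same line, and \<open>outer\<close> is
      even.\<close>
    proof (rule covering_space_lift_unique[OF covering_space_outer, where T = "{0..1}" and a = 0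
          and f = "\<lambda>t. h (t, v)" and ?g1.0 = "\<lambda>t. - k (t, - v)" and ?g2.0 = "\<lambda>t. k (t, v)"])
      show "- k (0, - v) = k (0, v)"
        using v v' by (simp add: k(3))
      show "continuous_on {0..1} (\<lambda>t. h (t, v))"
        using v by (intro continuous_on_compose2[OF h] continuous_intros) auto
      show "(\<lambda>t. h (t, v)) \<in> {0..1} \<rightarrow> outer ` ?S"
        using him v by auto
      show "continuous_on {0..1} (\<lambda>t. - k (t, - v))" "continuous_on {0..1} (\<lambda>t. k (t, v))"
        using pair v v' by (auto intro: continuous_on_minus)
      show "(\<lambda>t. - k (t, - v)) \<in> {0..1} \<rightarrow> ?S" "(\<lambda>t. k (t, v)) \<in> {0..1} \<rightarrow> ?S"
        using k(2) v v' by fastforce+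
      show "h (t, v) = outer (- k (t, - v))" "h (t, v) = outer (k (t, v))" if "t \<in> {0..1}" for t
        using k(4)[of "(t, v)"] k(4)[of "(t, - v)"] that v v' by (simp_all add: h_def)
    qed auto
    then show ?thesis
      by (metis minus_minus)
  qed
  obtain v :: "real ^ 'm" where v: "norm v = 1"
    using vector_choose_size[of 1] by auto
  define w where "w = k (1, v)"
  have w: "norm w = 1"
    using k(2) v by (auto simp: w_def)
  have end_point: "k (1, u) = w \<or> k (1, u) = - w" if u: "u \<in> ?S" for u
  proof -
    \<comment> \<open>All paths end at the same line \<open>L'\<close>.\<close>
    have "outer (k (1, u)) = outer w"
      using k(4)[of "(1, u)"] k(4)[of "(1, v)"] u v by (simp add: w_def h_def finish proj_in)
    moreover have "norm (k (1, u)) = 1"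
      using k(2) u by auto
    ultimately show ?thesis
      using outer_eq_iff w by blast
  qed
  have "connected ((\<lambda>u. k (1, u) \<bullet> w) ` ?S)"
  proof (rule connected_continuous_image)
    show "continuous_on ?S (\<lambda>u. k (1, u) \<bullet> w)"
      by (intro continuous_intros continuous_on_compose2[OF k(1)]) auto
    show "connected ?S"
      \<comment> \<open>In dimension 1 the unit sphere is a pair of points, hence the bound on
        \<open>CARD('m)\<close>.\<close>
      using dim by (intro connected_sphere) simp
  qed
  moreover have "- 1 \<in> (\<lambda>u. k (1, u) \<bullet> w) ` ?S"
    using odd[of v] v w by (auto simp: norm_eq_1 w_def intro!: image_eqI[of _ _ "- v"])
  moreover have "1 \<in> (\<lambda>u. k (1, u) \<bullet> w) ` ?S"
    using v w by (auto simp: norm_eq_1 w_def intro!: image_eqI[of _ _ v])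
  \<comment> \<open>By \<open>end_point\<close> the function takes only the values 1 and -1, yet it
    takes both on a connected set.\<close>
  ultimately have "0 \<in> (\<lambda>u. k (1, u) \<bullet> w) ` ?S"
    by (rule connectedD_interval) simp_all
  then obtain u where "u \<in> ?S" "k (1, u) \<bullet> w = 0"
    by auto
  with end_point[of u] w show False
    by (auto simp: norm_eq_1)
qed

text \<open>A measure with at most one atom is a Dirac measure. Freezing the second line then leaves
  a continuous choice of paths from every line to a fixed one.\<close>

lemma no_section_of_diracs:
  fixes \<rho> :: "(real \<Rightarrow> (real ^ 'm) set) \<Rightarrow> (real \<Rightarrow> (real ^ 'm) set) \<Rightarrow> real"
  assumes dim: "CARD('m::finite) \<ge> 2"
    and "Metric_space (paths projective_space) \<rho>"
    and top: "Metric_space.mtopology (paths projective_space) \<rho> = path_topology projective_space"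
  shows "\<not> equivariant_section G actE (paths projective_space) \<rho> actB
    (prod_topology projective_space projective_space) path_endpoints 1 s"
proof
  let ?X = "projective_space :: (real ^ 'm) set topology"
  interpret Metric_space "paths ?X" \<rho>
    by fact
  assume s: "equivariant_section G actE (paths ?X) \<rho> actB (prod_topology ?X ?X) path_endpoints 1 s"
  then have cont: "continuous_map (prod_topology ?X ?X) (finsupp_topology (paths ?X) \<rho> 1) s"
    by (simp add: equivariant_section_def continuous_map_in_subtopology)
  from s have fib: "s x \<in> fibre_measures (paths ?X) (prod_topology ?X ?X) path_endpoints 1"
    and proj: "fibre_projection (paths ?X) (prod_topology ?X ?X) path_endpoints (s x) = x"
    if "x \<in> topspace (prod_topology ?X ?X)" for x
    using that by (auto simp: equivariant_section_def continuous_map_in_subtopology)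
  define f where "f x = (THE \<phi>. s x = return_pmf \<phi>)" for x
  have f: "s x = return_pmf (f x) \<and> f x \<in> paths ?X \<and> path_endpoints (f x) = x"
    if x: "x \<in> topspace (prod_topology ?X ?X)" for x
  proof -
    obtain y where y: "y \<in> topspace (prod_topology ?X ?X)"
      "set_pmf (s x) \<subseteq> {\<phi> \<in> paths ?X. path_endpoints \<phi> = y}"
      using fib[OF x] by (auto simp: fibre_measures_def)
    have "y = x"
      using fibre_projection_eq[OF y] proj[OF x] by simp
    have "finite (set_pmf (s x))" "card (set_pmf (s x)) \<le> 1"
      using fib[OF x] by (auto simp: fibre_measures_def finsupp_measures_def)
    then have "card (set_pmf (s x)) = 1"
      using set_pmf_not_empty[of "s x"] by (simp add: le_Suc_eq)
    then obtain \<phi> where "s x = return_pmf \<phi>"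
      by (auto simp: card_1_singleton_iff set_pmf_subset_singleton[symmetric])
    moreover from this have "f x = \<phi>"
      by (auto simp: f_def)
    ultimately show ?thesis
      using y(2) \<open>y = x\<close> by simp
  qed
  obtain w :: "real ^ 'm" where "norm w = 1"
    using vector_choose_size[of 1] by auto
  then have L': "proj_class w \<in> topspace ?X"
    by (simp flip: proj_class_image_sphere)
  have "continuous_map ?X (prod_topology ?X ?X) (\<lambda>L. (L, proj_class w))"
    using L' by (auto intro!: continuous_map_pairedI)
  from continuous_map_compose[OF this cont]
  have "continuous_map ?X (finsupp_topology (paths ?X) \<rho> 1) (\<lambda>L. return_pmf (f (L, proj_class w)))"
    by (rule continuous_map_eq) (use f L' in auto)
  then have "continuous_map ?X (path_topology ?X) (\<lambda>L. f (L, proj_class w))"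
    unfolding top[symmetric] by (rule continuous_map_dirac) (use f L' in auto)
  then show False
    by (rule no_contraction_projective_space[OF dim, where L' = "proj_class w"])
       (use f L' in \<open>auto simp: path_endpoints_def\<close>)
qed

theorem proposition7p12:
  fixes \<rho> :: "(real \<Rightarrow> (real ^ 'n::finite option) set) \<Rightarrow> (real \<Rightarrow> (real ^ 'n option) set) \<Rightarrow> real"
  assumes "Metric_space (paths (projective_space :: (real ^ 'n option) set topology)) \<rho>"
    and "Metric_space.mtopology (paths projective_space) \<rho> = path_topology projective_space"
  shows "dTC (special_orthogonal :: (real ^ 'n ^ 'n) set) projective_action projective_space \<rho> = 1"
proof -
  let ?N = "{n. \<exists>s. equivariant_section (special_orthogonal :: (real ^ 'n ^ 'n) set)
    (path_action projective_action) (paths projective_space) \<rho> (diagonal_action projective_action)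
    (prod_topology projective_space projective_space) path_endpoints (n + 1) s}"
  \<comment> \<open>The type \<open>'n\<close> is nonempty, which is the hypothesis that n is at
    least 1.\<close>
  have dim: "CARD('n option) \<ge> 2"
    using zero_less_card_finite[where 'a = 'n] by simp
  \<comment> \<open>The index is one less than the number of atoms: 0 stands for Dirac measures, 1
    for two atoms.\<close>
  have "0 \<notin> ?N"
    by (simp add: no_section_of_diracs[OF dim assms, simplified])
  moreover have "1 \<in> ?N"
    using equivariant_section_two_paths_section[OF assms] by (auto simp: numeral_2_eq_2)
  ultimately have "Inf (enat ` ?N) = enat 1"
    by (intro antisym Inf_lower Inf_greatest) (auto simp: Suc_le_eq intro!: gr0I)
  then show ?thesis
    by (simp add: dTC_def dsecat_def one_enat_def)
qed

end
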